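(* For all extended configurations $\mathcal C_1,\mathcal C_2$: $\mathcal C_1\approx_{\mathsf{Canco}}\mathcal C_2$ if and only if $\mathcal L_{\mathsf{Canco}}(\mathcal C_1)=\mathcal L_{\mathsf{Canco}}(\mathcal C_2)$.
   Context: LANGUAGE. $\mathsf{Act}$ is an infinite set of actions with CCS complementation ($\bar{\bar a}=a$); $\tau\notin\mathsf{Act}$; $\mu$ ranges over $\mathsf{Act}\cup\{\tau\}$. Transaction names: $\mathsf{TrN}=\mathsf{inTrN}\uplus\mathsf{exTrN}$ (internal and external names, both infinite). Terms: $P,Q::=\sum_{i\in J}\mu_i.P_i$ ($J$ countable; $\mathbf 0$ is the empty sum) $\mid P\mid Q\mid\nu a.P\mid X\mid\mathrm{rec}X.P\mid[\![P\triangleright_kQ]\!]$ (running transaction named $k$) $\mid\mathrm{co}\mid[\![P\blacktriangleright Q]\!]$ (dormant transaction). $ftn(o)$ is the set of transaction names in $o$; $o\,\sharp\,o'$ means no transaction name of $o$ occurs in $o'$. A process is a well-formed term: (1) it is closed (no free process variables); (2) $ftn$ of it is finite; and for all subterms $[\![P_1\triangleright_kP_1']\!]$, $[\![P_2\blacktriangleright P_2']\!]$, $\sum\mu_i.Q_i$, $\mathrm{rec}X.R$: (3) $P_1,P_1',P_2,P_2',Q_i,R$ contain no transaction names; (4) $P_1,P_2,Q_i$ contain no dormant transactions; (5) $P_1,P_2$ are closed. PROCESS TRANSITIONS. $P\xrightarrow{\alpha}_\sigma Q$ with $\alpha\in\{a,\tau,k(\tau),k(a)\}$ and $\sigma$ a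 name substitution $\tilde k\mapsto l$ (domain the finite tuple $\tilde k$, possibly empty, range $\{l\}$; $\varepsilon$ alone is the empty substitution). Rules (symmetric ones omitted): - $\sum\mu_i.P_i\xrightarrow{\mu_j}_\varepsilon P_j$; - if $P\xrightarrow{a}_\varepsilon P'$ and $Q\xrightarrow{\bar a}_\varepsilon Q'$ then $P\mid Q\xrightarrow{\tau}_\varepsilon P'\mid Q'$; - $\mathrm{rec}X.P\xrightarrow{\tau}_\varepsilon P[\mathrm{rec}X.P/X]$; - if $\mu_j=a$ then $\sum\mu_i.P_i\xrightarrow{k(a)}_{\varepsilon\mapsto k}[\![P_j\mid\mathrm{co}\triangleright_k\sum\mu_i.P_i]\!]$; - if $P\xrightarrow{\mu}_\varepsilon P'$ and $k\,\sharp\,l$ then $[\![P\triangleright_lQ]\!]\xrightarrow{k(\mu)}_{l\mapsto k}[\![P'\triangleright_kQ]\!]$; - if $P\xrightarrow{k(a)}_{\sigma_1}P'$, $Q\xrightarrow{k(\bar a)}_{\sigma_2}Q'$, $\sigma_i=\tilde l_i\mapsto k$, then $P\mid Q\xrightarrow{k(\tau)}_{(\tilde l_1,\tilde l_2)\mapsto k}P'\sigma_2\mid Q'\sigma_1$; - if $P\xrightarrow{\alpha}_\sigma P'$ and $range(\sigma)\,\sharp\,Q$ then $P\mid Q\xrightarrow{\alpha}_\sigma P'\mid Q\sigma$; - if $P\xrightarrow{\alpha}_\sigma P'$ and $a$ does not occur in $\alpha$ then $\nu a.P\xrightarrow{\alpha}_\sigma\nu a.P'$. Reconfiguration transitions $P\xrightarrow{\beta}Q$,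 $\beta\in\{\mathrm{co}\,k,\mathrm{ab}\,k,\mathrm{new}\,k\}$ (symmetric rules omitted): - if $P\equiv\mathrm{co}\mid P''$ for some $P''$ and $P\rightsquigarrow_{\mathrm{co}}P'$ then $[\![P\triangleright_kQ]\!]\xrightarrow{\mathrm{co}\,k}P'$; - $[\![P\blacktriangleright Q]\!]\xrightarrow{\mathrm{new}\,k}[\![P\triangleright_kQ]\!]$; - $[\![P\triangleright_kQ]\!]\xrightarrow{\mathrm{ab}\,k}Q$; - for $\beta=\mathrm{co}\,k$ or $\mathrm{ab}\,k$: if $P\xrightarrow{\beta}P'$ and $Q\xrightarrow{\beta}Q'$ then $P\mid Q\xrightarrow{\beta}P'\mid Q'$; - if $P\xrightarrow{\beta}P'$ and $\beta\,\sharp\,Q$ then $P\mid Q\xrightarrow{\beta}P'\mid Q$; - if $P\xrightarrow{\beta}P'$ then $\nu a.P\xrightarrow{\beta}\nu a.P'$. Here $\equiv$ is standard CCS structural equivalence extended to transactions, and $\rightsquigarrow_{\mathrm{co}}$ is given by: $\mathrm{co}\rightsquigarrow_{\mathrm{co}}\mathbf 0$; sums, variables, $\mathrm{rec}X.P$ and $[\![P\blacktriangleright Q]\!]$ are related to themselves; it is compatible with $\nu a.-$ and $-\mid-$. EXTENDED CONFIGURATIONS. $I$ is a countable index set. An extended configuration is $\langle E;H\bullet P\rangle$ with $P$ a process, $E$ an equivalence relation over a finite subset of $\mathsf{TrN}$, and $H$ a finite partial function from $I$ to $\{k(a),k(\mathrm{ab}),k(\mathrm{co})\mid k\in\mathsf{exTrN},a\in\mathsf{Act}\}$.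 Let $H^{\mathrm{trn}}(i)$ be the name used in $H(i)$, $H^{\mathrm{trn}}$ the set of all these, and $\mathrm{Hasco}(H)=\{k\mid\exists i.\,H(i)=k(\mathrm{co})\}$. It is required that: (i) $H^{\mathrm{trn}}(i)=H^{\mathrm{trn}}(j)$ implies $i=j$; (ii) for $k\in\mathsf{exTrN}$, $k\,E\,k$ iff $k\in H^{\mathrm{trn}}$, and $k\,E\,k'$ implies ($k\in\mathrm{Hasco}(H)$ iff $k'\in\mathrm{Hasco}(H)$); (iii) $ftn(P)\cap\mathrm{Hasco}(H)=\emptyset$; (iv) $k\,E\,k'$ and $k,k'\in ftn(P)$ imply $k=k'$. Convention: external names of a configuration are those in its history, i.e. $ftn(P)\cap\mathsf{exTrN}\subseteq H^{\mathrm{trn}}$. "$H,k(a)$" denotes $H$ extended at a new index. For $\sigma=\tilde k\mapsto l$, $\sigma(E)$ is the smallest equivalence relation $F\supseteq E$ with $l\,F\,l$ and $k\,F\,l$ for all $k\in dom(\sigma)$. $(E;H)\setminus_{\mathrm{co}}k$ (resp. $\setminus_{\mathrm{ab}}k$) keeps $E$ and, for every $k'\,E\,k$, changes each $k'(a)$ in $H$ to $k'(\mathrm{co})$ (resp. $k'(\mathrm{ab})$). COMMIT-SENSITIVE TRANSITIONS AND $\approx_{\mathsf{Canco}}$. Let $E_{ext}(k)=\{k'\in\mathsf{exTrN}\mid k\,E\,k'\}$. With $\Delta=E;H$, the commit-sensitive transitions between extended configurations are: - $\langle\Delta\bullet P\rangle\xrightarrow{\tau}_c\langle\Delta\bullet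 Q\rangle$ if $P\xrightarrow{\tau}_\varepsilon Q$; - $\xrightarrow{\tau}_c\langle\sigma(E);H\bullet Q\rangle$ if $P\xrightarrow{k(\tau)}_\sigma Q$, $k\,\sharp\,\Delta$, $k\in\mathsf{inTrN}$; - $\xrightarrow{\tau}_c\langle\Delta\bullet Q\rangle$ if $P\xrightarrow{\mathrm{new}\,k}Q$, $k\,\sharp\,\Delta$, $k\in\mathsf{inTrN}$; - $\xrightarrow{\mathrm{co}(E_{ext}(k))}_c\langle\Delta\setminus_{\mathrm{co}}k\bullet Q\rangle$ if $P\xrightarrow{\mathrm{co}\,k}Q$ and $E_{ext}(k)\neq\emptyset$; - $\xrightarrow{\tau}_c\langle\Delta\setminus_{\mathrm{co}}k\bullet Q\rangle$ if $P\xrightarrow{\mathrm{co}\,k}Q$ and $E_{ext}(k)=\emptyset$; - $\xrightarrow{\tau}_c\langle\Delta\setminus_{\mathrm{ab}}k\bullet Q\rangle$ if $P\xrightarrow{\mathrm{ab}\,k}Q$; - $\xrightarrow{k(a)}_c\langle\sigma(E);H,k(a)\bullet Q\rangle$ if $P\xrightarrow{k(a)}_\sigma Q$, $k\,\sharp\,\Delta$, $k\in\mathsf{exTrN}$; - $\xrightarrow{k(a)}_c\langle E\cup(k,k);H,k(\mathrm{ab})\bullet P\rangle$ if $k\,\sharp\,\Delta$, $k\in\mathsf{exTrN}$. $\stackrel{\tau}{\Rightarrow}_c$ is $(\xrightarrow{\tau}_c)^*$ and $\stackrel{\zeta}{\Rightarrow}_c$ is $\stackrel{\tau}{\Rightarrow}_c\xrightarrow{\zeta}_c\stackrel{\tau}{\Rightarrow}_c$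 otherwise. A relation $\mathcal R$ on extended configurations is a commit-sensitive bisimulation if $\mathcal C_1\mathcal R\mathcal C_2$ implies: (i) for $\zeta\in\{\tau,k(a)\}$, if $\mathcal C_1\stackrel{\zeta}{\Rightarrow}_c\mathcal C_1'$ with $\zeta\,\sharp\,\mathcal C_2$ then $\mathcal C_2\stackrel{\zeta}{\Rightarrow}_c\mathcal C_2'$ for some $\mathcal C_2'$ with $\mathcal C_1'\mathcal R\mathcal C_2'$; (ii) for $K\subseteq\mathsf{exTrN}$, if $\mathcal C_1\stackrel{\mathrm{co}(K)}{\Rightarrow}_c\mathcal C_1'$ then $\mathcal C_2\stackrel{\mathrm{co}(K)}{\Rightarrow}_c\mathcal C_2'$ for some $\mathcal C_2'$ with $\mathcal C_1'\mathcal R\mathcal C_2'$; (iii) the converses. $\approx_{\mathsf{Canco}}$ is the largest one. LOGIC $\mathcal L_{\mathsf{Canco}}$. $\mathsf{Var}$ is a countable set of variables disjoint from $\mathsf{exTrN}$. Formulae: $\phi::=\langle\tau\rangle\phi\mid\langle x(a)\rangle\phi\mid\neg\phi\mid\bigwedge_{i\in M}\phi_i$ ($M$ an arbitrary index set) $\mid\langle\mathrm{co}(K)\rangle\phi$, with $x\in\mathsf{Var}$, $a\in\mathsf{Act}$, $\emptyset\neq K\subseteq\mathsf{exTrN}\uplus\mathsf{Var}$; $\langle x(a)\rangle\phi$ binds $x$ in $\phi$; closed formulae have no free variables. Satisfaction for closed formulae: $\mathcal C\models\langle\mathrm{co}(K)\rangle\phi$ iff $\mathcal C\stackrel{\mathrm{co}(K)}{\Rightarrow}_c\mathcal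 C'$ with $\mathcal C'\models\phi$ for some $\mathcal C'$; $\mathcal C\models\langle\tau\rangle\phi$ iff $\mathcal C\stackrel{\tau}{\Rightarrow}_c\mathcal C'$ with $\mathcal C'\models\phi$ for some $\mathcal C'$; $\mathcal C\models\langle x(a)\rangle\phi$ iff there is a cofinite $N\subseteq\mathsf{exTrN}$ such that for all $l\in N$ there is $\mathcal C'$ with $\mathcal C\stackrel{l(a)}{\Rightarrow}_c\mathcal C'$ and $\mathcal C'\models\phi[l/x]$; conjunction and negation are standard. $\mathcal L_{\mathsf{Canco}}(\mathcal C)$ is the set of closed $\phi$ with $\mathcal C\models\phi$. *)

theory Defs
  imports Main "HOL-Library.Infinite_Typeclass"
begin

section \<open>Actions and transaction names\<close>

text \<open>
  CCS actions: names and conames over an infinite supply of channels, so complementation is an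
  involution without fixed points. Process terms are taken up to renaming of restricted channels
  by representing a channel bound by a restriction as a de Bruijn index (counting enclosing
  restrictions); this makes the substitution in the unfolding of recursion capture-avoiding even
  when an infinite sum mentions every channel. Both polarities of a bound channel are bound.
\<close>

datatype 'c act = Name 'c | Coname 'c

fun bar :: "'c act \<Rightarrow> 'c act" where
  "bar (Name c) = Coname c"
| "bar (Coname c) = Name c"

datatype 'a chan = Free 'a | Bound nat

fun ren_chan :: "(nat \<Rightarrow> nat) \<Rightarrow> 'a chan \<Rightarrow> 'a chan" where
  "ren_chan r (Free a) = Free a"
| "ren_chan r (Bound n) = Bound (r n)"

datatype 'c pre = Tau | Vis "'c act"

datatype ('n, 'x) trn = Internal 'n | External 'x


section \<open>Terms\<close>

text \<open>
  A countable sum is a partial function on the naturals; its domain is the index set.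
  \<open>Res P\<close> is restriction of the channel with index 0 in \<open>P\<close>; \<open>Run P k Q\<close> is a running transaction
  named \<open>k\<close> with default \<open>P\<close> and alternative \<open>Q\<close>; \<open>Dormant P Q\<close> a dormant one.
  Since transaction names are never bound in terms, the set and map functions generated by the
  datatype are exactly the set of transaction names and the action of a name substitution.
\<close>

datatype (dead 'a, ftn: 'k) proc =
    Sum "nat \<Rightarrow> ('a chan pre \<times> ('a, 'k) proc) option"
  | Par "('a, 'k) proc" "('a, 'k) proc"
  | Res "('a, 'k) proc"
  | PVar nat
  | Rec nat "('a, 'k) proc"
  | Run "('a, 'k) proc" 'k "('a, 'k) proc"
  | Co
  | Dormant "('a, 'k) proc" "('a, 'k) proc"
  for map: map_trn

abbreviation Inert :: "('a, 'k) proc" where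
  "Inert \<equiv> Sum Map.empty"

fun up :: "(nat \<Rightarrow> nat) \<Rightarrow> nat \<Rightarrow> nat" where
  "up r 0 = 0"
| "up r (Suc n) = Suc (r n)"

primrec ren :: "('a, 'k) proc \<Rightarrow> (nat \<Rightarrow> nat) \<Rightarrow> ('a, 'k) proc" where
  "ren (Sum f) r = Sum (\<lambda>i. map_option (map_prod (map_pre (ren_chan r)) (\<lambda>P. ren P r)) (f i))"
| "ren (Par P Q) r = Par (ren P r) (ren Q r)"
| "ren (Res P) r = Res (ren P (up r))"
| "ren (PVar X) r = PVar X"
| "ren (Rec X P) r = Rec X (ren P r)"
| "ren (Run P k Q) r = Run (ren P r) k (ren Q r)"
| "ren Co r = Co"
| "ren (Dormant P Q) r = Dormant (ren P r) (ren Q r)"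

abbreviation lift :: "('a, 'k) proc \<Rightarrow> ('a, 'k) proc" where
  "lift P \<equiv> ren P Suc"

text \<open>
  \<open>psubst P X R\<close> is \<open>P[R/X]\<close>. It avoids capture of channels; process variables cannot be captured
  because it is only used with closed \<open>R\<close>.
\<close>

primrec psubst :: "('a, 'k) proc \<Rightarrow> nat \<Rightarrow> ('a, 'k) proc \<Rightarrow> ('a, 'k) proc" where
  "psubst (Sum f) X R = Sum (\<lambda>i. map_option (map_prod id (\<lambda>P. psubst P X R)) (f i))"
| "psubst (Par P Q) X R = Par (psubst P X R) (psubst Q X R)"
| "psubst (Res P) X R = Res (psubst P X (lift R))"
| "psubst (PVar Y) X R = (if X = Y then R else PVar Y)"
| "psubst (Rec Y P) X R = (if X = Y then Rec Y P else Rec Y (psubst P X R))"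
| "psubst (Run P k Q) X R = Run (psubst P X R) k (psubst Q X R)"
| "psubst Co X R = Co"
| "psubst (Dormant P Q) X R = Dormant (psubst P X R) (psubst Q X R)"


section \<open>Processes\<close>

inductive subterm :: "('a, 'k) proc \<Rightarrow> ('a, 'k) proc \<Rightarrow> bool" where
  "subterm P P"
| "f i = Some (\<mu>, P) \<Longrightarrow> subterm T P \<Longrightarrow> subterm T (Sum f)"
| "subterm T P \<Longrightarrow> subterm T (Par P Q)"
| "subterm T Q \<Longrightarrow> subterm T (Par P Q)"
| "subterm T P \<Longrightarrow> subterm T (Res P)"
| "subterm T P \<Longrightarrow> subterm T (Rec X P)"
| "subterm T P \<Longrightarrow> subterm T (Run P k Q)"
| "subterm T Q \<Longrightarrow> subterm T (Run P k Q)"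
| "subterm T P \<Longrightarrow> subterm T (Dormant P Q)"
| "subterm T Q \<Longrightarrow> subterm T (Dormant P Q)"

inductive free_var :: "nat \<Rightarrow> ('a, 'k) proc \<Rightarrow> bool" where
  "free_var X (PVar X)"
| "f i = Some (\<mu>, P) \<Longrightarrow> free_var X P \<Longrightarrow> free_var X (Sum f)"
| "free_var X P \<Longrightarrow> free_var X (Par P Q)"
| "free_var X Q \<Longrightarrow> free_var X (Par P Q)"
| "free_var X P \<Longrightarrow> free_var X (Res P)"
| "free_var X P \<Longrightarrow> X \<noteq> Y \<Longrightarrow> free_var X (Rec Y P)"
| "free_var X P \<Longrightarrow> free_var X (Run P k Q)"
| "free_var X Q \<Longrightarrow> free_var X (Run P k Q)"
| "free_var X P \<Longrightarrow> free_var X (Dormant P Q)"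
| "free_var X Q \<Longrightarrow> free_var X (Dormant P Q)"

definition closed_term :: "('a, 'k) proc \<Rightarrow> bool" where
  "closed_term P \<longleftrightarrow> (\<forall>X. \<not> free_var X P)"

text \<open>
  \<open>dangling n P\<close>: the index referring to the \<open>n\<close>-th restriction around \<open>P\<close> occurs in \<open>P\<close>. Terms
  without dangling indices are the representatives of the terms with named restriction.
\<close>

inductive dangling :: "nat \<Rightarrow> ('a, 'k) proc \<Rightarrow> bool" where
  "f i = Some (\<mu>, P) \<Longrightarrow> Bound n \<in> set_pre \<mu> \<Longrightarrow> dangling n (Sum f)"
| "f i = Some (\<mu>, P) \<Longrightarrow> dangling n P \<Longrightarrow> dangling n (Sum f)"
| "dangling n P \<Longrightarrow> dangling n (Par P Q)"
| "dangling n Q \<Longrightarrow> dangling n (Par P Q)"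
| "dangling (Suc n) P \<Longrightarrow> dangling n (Res P)"
| "dangling n P \<Longrightarrow> dangling n (Rec X P)"
| "dangling n P \<Longrightarrow> dangling n (Run P k Q)"
| "dangling n Q \<Longrightarrow> dangling n (Run P k Q)"
| "dangling n P \<Longrightarrow> dangling n (Dormant P Q)"
| "dangling n Q \<Longrightarrow> dangling n (Dormant P Q)"

definition no_dormant :: "('a, 'k) proc \<Rightarrow> bool" where
  "no_dormant P \<longleftrightarrow> (\<forall>Q R. \<not> subterm (Dormant Q R) P)"

definition process :: "('a, 'k) proc \<Rightarrow> bool" where
  "process P \<longleftrightarrow>
     (\<forall>n. \<not> dangling n P) \<and>
     closed_term P \<and>
     finite (ftn P) \<and>
     (\<forall>P1 k P1'. subterm (Run P1 k P1') P \<longrightarrow>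
        ftn P1 = {} \<and> ftn P1' = {} \<and> no_dormant P1 \<and> closed_term P1) \<and>
     (\<forall>P2 P2'. subterm (Dormant P2 P2') P \<longrightarrow>
        ftn P2 = {} \<and> ftn P2' = {} \<and> no_dormant P2 \<and> closed_term P2) \<and>
     (\<forall>f i \<mu> Q. subterm (Sum f) P \<longrightarrow> f i = Some (\<mu>, Q) \<longrightarrow> ftn Q = {} \<and> no_dormant Q) \<and>
     (\<forall>X R. subterm (Rec X R) P \<longrightarrow> ftn R = {})"


section \<open>Process transitions\<close>

text \<open>\<open>Eps\<close> is the empty substitution, with empty range; \<open>Onto ks l\<close> maps the tuple \<open>ks\<close> to \<open>l\<close>
  and has range \<open>{l}\<close> even if \<open>ks\<close> is empty.\<close>

datatype 'k nsub = Eps | Onto "'k list" 'k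

fun dom_sub :: "'k nsub \<Rightarrow> 'k set" where
  "dom_sub Eps = {}"
| "dom_sub (Onto ks l) = set ks"

fun range_sub :: "'k nsub \<Rightarrow> 'k set" where
  "range_sub Eps = {}"
| "range_sub (Onto ks l) = {l}"

fun app_sub :: "'k nsub \<Rightarrow> 'k \<Rightarrow> 'k" where
  "app_sub Eps k = k"
| "app_sub (Onto ks l) k = (if k \<in> set ks then l else k)"

abbreviation sub_proc :: "('a, 'k) proc \<Rightarrow> 'k nsub \<Rightarrow> ('a, 'k) proc" where
  "sub_proc P \<sigma> \<equiv> map_trn (app_sub \<sigma>) P"

datatype ('c, 'k) label = Plain "'c pre" | Named 'k "'c pre"

text \<open>
  In the rule for restriction the label of the premise must be a shifted label: this says that the
  restricted channel, which has index 0 in \<open>P\<close>, does not occur in it. The communication rules need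
  no symmetric variant because \<open>a\<close> ranges over names and conames.
\<close>

inductive ptrans ::
  "('a, 'k) proc \<Rightarrow> ('a chan, 'k) label \<Rightarrow> 'k nsub \<Rightarrow> ('a, 'k) proc \<Rightarrow> bool" where
  "f j = Some (\<mu>, P) \<Longrightarrow> ptrans (Sum f) (Plain \<mu>) Eps P"
| "ptrans P (Plain (Vis a)) Eps P' \<Longrightarrow> ptrans Q (Plain (Vis (bar a))) Eps Q' \<Longrightarrow>
     ptrans (Par P Q) (Plain Tau) Eps (Par P' Q')"
| "ptrans (Rec X P) (Plain Tau) Eps (psubst P X (Rec X P))"
| "f j = Some (Vis a, P) \<Longrightarrow>
     ptrans (Sum f) (Named k (Vis a)) (Onto [] k) (Run (Par P Co) k (Sum f))"
| "ptrans P (Plain \<mu>) Eps P' \<Longrightarrow> k \<noteq> l \<Longrightarrow>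
     ptrans (Run P l Q) (Named k \<mu>) (Onto [l] k) (Run P' k Q)"
| "ptrans P (Named k (Vis a)) \<sigma>1 P' \<Longrightarrow> ptrans Q (Named k (Vis (bar a))) \<sigma>2 Q' \<Longrightarrow>
     \<sigma>1 = Onto ls1 k \<Longrightarrow> \<sigma>2 = Onto ls2 k \<Longrightarrow>
     ptrans (Par P Q) (Named k Tau) (Onto (ls1 @ ls2) k) (Par (sub_proc P' \<sigma>2) (sub_proc Q' \<sigma>1))"
| "ptrans P \<alpha> \<sigma> P' \<Longrightarrow> range_sub \<sigma> \<inter> ftn Q = {} \<Longrightarrow>
     ptrans (Par P Q) \<alpha> \<sigma> (Par P' (sub_proc Q \<sigma>))"
| "ptrans Q \<alpha> \<sigma> Q' \<Longrightarrow> range_sub \<sigma> \<inter> ftn P = {} \<Longrightarrow>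
     ptrans (Par P Q) \<alpha> \<sigma> (Par (sub_proc P \<sigma>) Q')"
| "ptrans P (map_label (ren_chan Suc) id \<alpha>) \<sigma> P' \<Longrightarrow> ptrans (Res P) \<alpha> \<sigma> (Res P')"

definition swap01 :: "nat \<Rightarrow> nat" where
  "swap01 n = (if n = 0 then 1 else if n = 1 then 0 else n)"

inductive scong :: "('a, 'k) proc \<Rightarrow> ('a, 'k) proc \<Rightarrow> bool" where
  "scong P P"
| "scong P Q \<Longrightarrow> scong Q P"
| "scong P Q \<Longrightarrow> scong Q R \<Longrightarrow> scong P R"
| "scong (Par P Inert) P"
| "scong (Par P Q) (Par Q P)"
| "scong (Par P (Par Q R)) (Par (Par P Q) R)"
| "scong (Res Inert) Inert"
| "scong (Res (Res P)) (Res (Res (ren P swap01)))"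
| "scong (Par P (Res Q)) (Res (Par (lift P) Q))"
| "bij_betw \<pi> (dom f) (dom g) \<Longrightarrow>
     (\<And>i \<mu> P. f i = Some (\<mu>, P) \<Longrightarrow> \<exists>Q. g (\<pi> i) = Some (\<mu>, Q) \<and> scong P Q) \<Longrightarrow>
     scong (Sum f) (Sum g)"
| "scong P P' \<Longrightarrow> scong Q Q' \<Longrightarrow> scong (Par P Q) (Par P' Q')"
| "scong P P' \<Longrightarrow> scong (Res P) (Res P')"
| "scong P P' \<Longrightarrow> scong (Rec X P) (Rec X P')"
| "scong P P' \<Longrightarrow> scong Q Q' \<Longrightarrow> scong (Run P k Q) (Run P' k Q')"
| "scong P P' \<Longrightarrow> scong Q Q' \<Longrightarrow> scong (Dormant P Q) (Dormant P' Q')"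

inductive co_red :: "('a, 'k) proc \<Rightarrow> ('a, 'k) proc \<Rightarrow> bool" where
  "co_red Co Inert"
| "co_red (Sum f) (Sum f)"
| "co_red (PVar X) (PVar X)"
| "co_red (Rec X P) (Rec X P)"
| "co_red (Dormant P Q) (Dormant P Q)"
| "co_red P P' \<Longrightarrow> co_red (Res P) (Res P')"
| "co_red P P' \<Longrightarrow> co_red Q Q' \<Longrightarrow> co_red (Par P Q) (Par P' Q')"

datatype 'k rlabel = RCo (rname: 'k) | RAb (rname: 'k) | RNew (rname: 'k)

inductive rtrans :: "('a, 'k) proc \<Rightarrow> 'k rlabel \<Rightarrow> ('a, 'k) proc \<Rightarrow> bool" where
  "scong P (Par Co P'') \<Longrightarrow> co_red P P' \<Longrightarrow> rtrans (Run P k Q) (RCo k) P'"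
| "rtrans (Dormant P Q) (RNew k) (Run P k Q)"
| "rtrans (Run P k Q) (RAb k) Q"
| "\<beta> = RCo k \<or> \<beta> = RAb k \<Longrightarrow> rtrans P \<beta> P' \<Longrightarrow> rtrans Q \<beta> Q' \<Longrightarrow>
     rtrans (Par P Q) \<beta> (Par P' Q')"
| "rtrans P \<beta> P' \<Longrightarrow> rname \<beta> \<notin> ftn Q \<Longrightarrow> rtrans (Par P Q) \<beta> (Par P' Q)"
| "rtrans Q \<beta> Q' \<Longrightarrow> rname \<beta> \<notin> ftn P \<Longrightarrow> rtrans (Par P Q) \<beta> (Par P Q')"
| "rtrans P \<beta> P' \<Longrightarrow> rtrans (Res P) \<beta> (Res P')"


section \<open>Extended configurations\<close>

datatype ('a, 'x) hist =
  HAct (hname: 'x) "'a act" | HAb (hname: 'x) | HCo (hname: 'x)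

text \<open>The countable index set of histories is the type of natural numbers. An equivalence relation
  over a subset of the transaction names is given by its graph; the subset is its field.\<close>

datatype ('a, 'n, 'x) config =
  Conf "(('n, 'x) trn \<times> ('n, 'x) trn) set" "nat \<Rightarrow> ('a, 'x) hist option" "('a, ('n, 'x) trn) proc"

definition htrn :: "(nat \<Rightarrow> ('a, 'x) hist option) \<Rightarrow> 'x set" where
  "htrn H = hname ` ran H"

definition hasco :: "(nat \<Rightarrow> ('a, 'x) hist option) \<Rightarrow> 'x set" where
  "hasco H = {k. \<exists>i. H i = Some (HCo k)}"

text \<open>Agreement of related names on being committed is required of external names only, since
  internal names never occur in histories. The last conjunct is the convention that the external
  names of a configuration are those in its history.\<close>

fun ext_config :: "('a, 'n, 'x) config \<Rightarrow> bool" where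
  "ext_config (Conf E H P) \<longleftrightarrow>
     process P \<and>
     finite (Field E) \<and> equiv (Field E) E \<and>
     finite (dom H) \<and>
     (\<forall>i j h h'. H i = Some h \<longrightarrow> H j = Some h' \<longrightarrow> hname h = hname h' \<longrightarrow> i = j) \<and>
     (\<forall>k. (External k, External k) \<in> E \<longleftrightarrow> k \<in> htrn H) \<and>
     (\<forall>k k'. (External k, External k') \<in> E \<longrightarrow> (k \<in> hasco H \<longleftrightarrow> k' \<in> hasco H)) \<and>
     ftn P \<inter> External ` hasco H = {} \<and>
     (\<forall>k k'. (k, k') \<in> E \<longrightarrow> k \<in> ftn P \<longrightarrow> k' \<in> ftn P \<longrightarrow> k = k') \<and>
     ftn P \<inter> range External \<subseteq> External ` htrn H"

definition delta_names ::
  "(('n, 'x) trn \<times> ('n, 'x) trn) set \<Rightarrow> (nat \<Rightarrow> ('a, 'x) hist option) \<Rightarrow> ('n, 'x) trn set" where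
  "delta_names E H = Field E \<union> External ` htrn H"

fun config_names :: "('a, 'n, 'x) config \<Rightarrow> ('n, 'x) trn set" where
  "config_names (Conf E H P) = delta_names E H \<union> ftn P"

definition sub_equiv :: "'k nsub \<Rightarrow> ('k \<times> 'k) set \<Rightarrow> ('k \<times> 'k) set" where
  "sub_equiv \<sigma> E = \<Inter> {F. equiv (Field F) F \<and> E \<subseteq> F \<and>
     (\<forall>l \<in> range_sub \<sigma>. (l, l) \<in> F \<and> (\<forall>k \<in> dom_sub \<sigma>. (k, l) \<in> F))}"

definition ext_class :: "(('n, 'x) trn \<times> ('n, 'x) trn) set \<Rightarrow> ('n, 'x) trn \<Rightarrow> 'x set" where
  "ext_class E k = {k'. (k, External k') \<in> E}"

text \<open>\<open>resolve HCo E k H\<close> and \<open>resolve HAb E k H\<close> are the histories after the commit, respectively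
  the abort, of \<open>k\<close>.\<close>

definition resolve ::
  "('x \<Rightarrow> ('a, 'x) hist) \<Rightarrow> (('n, 'x) trn \<times> ('n, 'x) trn) set \<Rightarrow> ('n, 'x) trn \<Rightarrow>
   (nat \<Rightarrow> ('a, 'x) hist option) \<Rightarrow> (nat \<Rightarrow> ('a, 'x) hist option)" where
  "resolve r E k H = (\<lambda>i. case H i of
       Some (HAct k' a) \<Rightarrow> Some (if (External k', k) \<in> E then r k' else HAct k' a)
     | h \<Rightarrow> h)"


section \<open>Commit-sensitive transitions and bisimilarity\<close>

datatype ('a, 'x) clabel = CTau | CAct 'x "'a act" | CCo "'x set"

inductive crule ::
  "('a, 'n, 'x) config \<Rightarrow> ('a, 'x) clabel \<Rightarrow> ('a, 'n, 'x) config \<Rightarrow> bool" where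
  "ptrans P (Plain Tau) Eps Q \<Longrightarrow> crule (Conf E H P) CTau (Conf E H Q)"
| "ptrans P (Named (Internal k) Tau) \<sigma> Q \<Longrightarrow> Internal k \<notin> delta_names E H \<Longrightarrow>
     crule (Conf E H P) CTau (Conf (sub_equiv \<sigma> E) H Q)"
| "rtrans P (RNew (Internal k)) Q \<Longrightarrow> Internal k \<notin> delta_names E H \<Longrightarrow>
     crule (Conf E H P) CTau (Conf E H Q)"
| "rtrans P (RCo k) Q \<Longrightarrow> ext_class E k \<noteq> {} \<Longrightarrow>
     crule (Conf E H P) (CCo (ext_class E k)) (Conf E (resolve HCo E k H) Q)"
| "rtrans P (RCo k) Q \<Longrightarrow> ext_class E k = {} \<Longrightarrow>
     crule (Conf E H P) CTau (Conf E (resolve HCo E k H) Q)"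
| "rtrans P (RAb k) Q \<Longrightarrow> crule (Conf E H P) CTau (Conf E (resolve HAb E k H) Q)"
| "ptrans P (Named (External k) (Vis (map_act Free a))) \<sigma> Q \<Longrightarrow>
     External k \<notin> delta_names E H \<Longrightarrow> i \<notin> dom H \<Longrightarrow>
     crule (Conf E H P) (CAct k a) (Conf (sub_equiv \<sigma> E) (H(i \<mapsto> HAct k a)) Q)"
| "External k \<notin> delta_names E H \<Longrightarrow> i \<notin> dom H \<Longrightarrow>
     crule (Conf E H P) (CAct k a)
       (Conf (E \<union> {(External k, External k)}) (H(i \<mapsto> HAb k)) P)"

text \<open>Transitions are between extended configurations, so both ends are required to be ones.\<close>

definition cstep ::
  "('a, 'n, 'x) config \<Rightarrow> ('a, 'x) clabel \<Rightarrow> ('a, 'n, 'x) config \<Rightarrow> bool" where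
  "cstep C \<zeta> C' \<longleftrightarrow> ext_config C \<and> ext_config C' \<and> crule C \<zeta> C'"

definition tau_steps :: "('a, 'n, 'x) config \<Rightarrow> ('a, 'n, 'x) config \<Rightarrow> bool" where
  "tau_steps = (\<lambda>C C'. cstep C CTau C')\<^sup>*\<^sup>*"

definition weak ::
  "('a, 'n, 'x) config \<Rightarrow> ('a, 'x) clabel \<Rightarrow> ('a, 'n, 'x) config \<Rightarrow> bool" where
  "weak C \<zeta> C' \<longleftrightarrow>
     (if \<zeta> = CTau then tau_steps C C'
      else \<exists>D D'. tau_steps C D \<and> cstep D \<zeta> D' \<and> tau_steps D' C')"

fun clabel_fresh :: "('a, 'x) clabel \<Rightarrow> ('a, 'n, 'x) config \<Rightarrow> bool" where
  "clabel_fresh CTau C \<longleftrightarrow> True"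
| "clabel_fresh (CAct k a) C \<longleftrightarrow> External k \<notin> config_names C"
| "clabel_fresh (CCo K) C \<longleftrightarrow> External ` K \<inter> config_names C = {}"

definition cs_simulation ::
  "(('a, 'n, 'x) config \<Rightarrow> ('a, 'n, 'x) config \<Rightarrow> bool) \<Rightarrow> bool" where
  "cs_simulation R \<longleftrightarrow> (\<forall>C1 C2. R C1 C2 \<longrightarrow>
     (\<forall>\<zeta> C1'. (\<zeta> = CTau \<or> (\<exists>k a. \<zeta> = CAct k a)) \<longrightarrow> weak C1 \<zeta> C1' \<longrightarrow> clabel_fresh \<zeta> C2 \<longrightarrow>
        (\<exists>C2'. weak C2 \<zeta> C2' \<and> R C1' C2')) \<and>
     (\<forall>K C1'. weak C1 (CCo K) C1' \<longrightarrow> (\<exists>C2'. weak C2 (CCo K) C2' \<and> R C1' C2')))"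

definition cs_bisimulation ::
  "(('a, 'n, 'x) config \<Rightarrow> ('a, 'n, 'x) config \<Rightarrow> bool) \<Rightarrow> bool" where
  "cs_bisimulation R \<longleftrightarrow>
     (\<forall>C1 C2. R C1 C2 \<longrightarrow> ext_config C1 \<and> ext_config C2) \<and>
     cs_simulation R \<and> cs_simulation R\<inverse>\<inverse>"

definition canco_bisimilar ::
  "('a, 'n, 'x) config \<Rightarrow> ('a, 'n, 'x) config \<Rightarrow> bool"  (infix \<open>\<approx>\<^sub>C\<close> 50) where
  "C1 \<approx>\<^sub>C C2 \<longleftrightarrow> (\<exists>R. cs_bisimulation R \<and> R C1 C2)"


section \<open>The logic\<close>

datatype 'x tname = TName 'x | TVar nat

text \<open>
  A conjunction is indexed by an arbitrary subset of \<open>'i\<close>, the domain of its partial function.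
  As HOL has no type of formulae with conjunctions over all sets, the index type is a parameter;
  for logical equivalence to be meaningful it has to be at least as large as the set of
  configurations, e.g. the sum of an arbitrary type with the type of configurations.
\<close>

datatype ('a, 'x, 'i) fml =
    DiaTau "('a, 'x, 'i) fml"
  | DiaAct nat "'a act" "('a, 'x, 'i) fml"
  | Neg "('a, 'x, 'i) fml"
  | Conj "'i \<Rightarrow> ('a, 'x, 'i) fml option"
  | DiaCo "'x tname set" "('a, 'x, 'i) fml"

inductive formula :: "('a, 'x, 'i) fml \<Rightarrow> bool" where
  "formula \<phi> \<Longrightarrow> formula (DiaTau \<phi>)"
| "formula \<phi> \<Longrightarrow> formula (DiaAct x a \<phi>)"
| "formula \<phi> \<Longrightarrow> formula (Neg \<phi>)"
| "(\<And>i \<phi>. F i = Some \<phi> \<Longrightarrow> formula \<phi>) \<Longrightarrow> formula (Conj F)"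
| "K \<noteq> {} \<Longrightarrow> formula \<phi> \<Longrightarrow> formula (DiaCo K \<phi>)"

inductive free_in :: "nat \<Rightarrow> ('a, 'x, 'i) fml \<Rightarrow> bool" where
  "free_in x \<phi> \<Longrightarrow> free_in x (DiaTau \<phi>)"
| "free_in x \<phi> \<Longrightarrow> x \<noteq> y \<Longrightarrow> free_in x (DiaAct y a \<phi>)"
| "free_in x \<phi> \<Longrightarrow> free_in x (Neg \<phi>)"
| "F i = Some \<phi> \<Longrightarrow> free_in x \<phi> \<Longrightarrow> free_in x (Conj F)"
| "TVar x \<in> K \<Longrightarrow> free_in x (DiaCo K \<phi>)"
| "free_in x \<phi> \<Longrightarrow> free_in x (DiaCo K \<phi>)"

definition closed_formula :: "('a, 'x, 'i) fml \<Rightarrow> bool" where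
  "closed_formula \<phi> \<longleftrightarrow> formula \<phi> \<and> (\<forall>x. \<not> free_in x \<phi>)"

primrec fsubst :: "('a, 'x, 'i) fml \<Rightarrow> 'x \<Rightarrow> nat \<Rightarrow> ('a, 'x, 'i) fml" where
  "fsubst (DiaTau \<phi>) l x = DiaTau (fsubst \<phi> l x)"
| "fsubst (DiaAct y a \<phi>) l x = DiaAct y a (if x = y then \<phi> else fsubst \<phi> l x)"
| "fsubst (Neg \<phi>) l x = Neg (fsubst \<phi> l x)"
| "fsubst (Conj F) l x = Conj (\<lambda>i. map_option (\<lambda>\<phi>. fsubst \<phi> l x) (F i))"
| "fsubst (DiaCo K \<phi>) l x =
     DiaCo ((\<lambda>t. if t = TVar x then TName l else t) ` K) (fsubst \<phi> l x)"

inductive immediate :: "('a, 'x, 'i) fml \<Rightarrow> ('a, 'x, 'i) fml \<Rightarrow> bool" where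
  "immediate \<phi> (DiaTau \<phi>)"
| "immediate (fsubst \<phi> l x) (DiaAct x a \<phi>)"
| "immediate \<phi> (Neg \<phi>)"
| "F i = Some \<phi> \<Longrightarrow> immediate \<phi> (Conj F)"
| "immediate \<phi> (DiaCo K \<phi>)"

inductive_cases immediate_DiaTauE: "immediate \<psi> (DiaTau \<phi>)"
inductive_cases immediate_DiaActE: "immediate \<psi> (DiaAct x a \<phi>)"
inductive_cases immediate_NegE: "immediate \<psi> (Neg \<phi>)"
inductive_cases immediate_ConjE: "immediate \<psi> (Conj F)"
inductive_cases immediate_DiaCoE: "immediate \<psi> (DiaCo K \<phi>)"

primrec fsubsts :: "('x \<times> nat) list \<Rightarrow> ('a, 'x, 'i) fml \<Rightarrow> ('a, 'x, 'i) fml" where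
  "fsubsts [] \<phi> = \<phi>"
| "fsubsts (p # s) \<phi> = fsubst (fsubsts s \<phi>) (fst p) (snd p)"

lemma fsubsts_DiaTau: "fsubsts s (DiaTau \<phi>) = DiaTau (fsubsts s \<phi>)"
  by (induction s) auto

lemma fsubsts_Neg: "fsubsts s (Neg \<phi>) = Neg (fsubsts s \<phi>)"
  by (induction s) auto

lemma fsubsts_Conj: "fsubsts s (Conj F) = Conj (\<lambda>i. map_option (fsubsts s) (F i))"
  by (induction s) (auto simp: option.map_comp o_def option.map_ident)

lemma fsubsts_DiaCo: "\<exists>K'. fsubsts s (DiaCo K \<phi>) = DiaCo K' (fsubsts s \<phi>)"
  by (induction s) auto

lemma fsubsts_DiaAct: "\<exists>s'. fsubsts s (DiaAct y a \<phi>) = DiaAct y a (fsubsts s' \<phi>)"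
proof (induction s)
  case Nil
  show ?case by (rule exI[of _ "[]"]) simp
next
  case (Cons p s)
  then obtain s' where s': "fsubsts s (DiaAct y a \<phi>) = DiaAct y a (fsubsts s' \<phi>)"
    by blast
  show ?case
    by (rule exI[of _ "if snd p = y then s' else p # s'"]) (simp add: s')
qed

lemma accp_immediate: "Wellfounded.accp immediate (fsubsts s \<phi>)"
proof (induction \<phi> arbitrary: s)
  case (DiaTau \<phi>)
  show ?case
    unfolding fsubsts_DiaTau
    by (rule accp.accI) (erule immediate_DiaTauE, simp add: DiaTau)
next
  case (DiaAct y a \<phi>)
  obtain s' where s': "fsubsts s (DiaAct y a \<phi>) = DiaAct y a (fsubsts s' \<phi>)"
    using fsubsts_DiaAct by blast
  have *: "Wellfounded.accp immediate (fsubst (fsubsts s' \<phi>) l y)" for l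
    using DiaAct[of "(l, y) # s'"] by simp
  show ?case
    unfolding s' by (rule accp.accI) (erule immediate_DiaActE, simp add: *)
next
  case (Neg \<phi>)
  show ?case
    unfolding fsubsts_Neg
    by (rule accp.accI) (erule immediate_NegE, simp add: Neg)
next
  case (Conj F)
  have *: "Wellfounded.accp immediate (fsubsts s \<phi>)" if "F i = Some \<phi>" for i \<phi>
    by (rule Conj[OF rangeI[of F i]]) (simp add: that)
  show ?case
    unfolding fsubsts_Conj
    by (rule accp.accI) (erule immediate_ConjE, auto dest: *)
next
  case (DiaCo K \<phi>)
  obtain K' where K': "fsubsts s (DiaCo K \<phi>) = DiaCo K' (fsubsts s \<phi>)"
    using fsubsts_DiaCo by blast
  show ?case
    unfolding K' by (rule accp.accI) (erule immediate_DiaCoE, simp add: DiaCo)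
qed

lemma wfp_immediate: "wfp immediate"
  by (rule accp_wfpI) (metis accp_immediate fsubsts.simps(1))

text \<open>Satisfaction is meant for closed formulae; there, the set \<open>K\<close> of a commit modality has no
  variables, i.e. is the image of a set of external names.\<close>

function sat :: "('a, 'n, 'x) config \<Rightarrow> ('a, 'x, 'i) fml \<Rightarrow> bool"  (infix \<open>\<Turnstile>\<close> 50) where
  "C \<Turnstile> DiaTau \<phi> \<longleftrightarrow> (\<exists>C'. weak C CTau C' \<and> C' \<Turnstile> \<phi>)"
| "C \<Turnstile> DiaAct x a \<phi> \<longleftrightarrow>
     (\<exists>N. finite (- N) \<and> (\<forall>l \<in> N. \<exists>C'. weak C (CAct l a) C' \<and> C' \<Turnstile> fsubst \<phi> l x))"
| "C \<Turnstile> Neg \<phi> \<longleftrightarrow> \<not> C \<Turnstile> \<phi>"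
| "C \<Turnstile> Conj F \<longleftrightarrow> (\<forall>i \<phi>. F i = Some \<phi> \<longrightarrow> C \<Turnstile> \<phi>)"
| "C \<Turnstile> DiaCo K \<phi> \<longleftrightarrow> (\<exists>K' C'. K = TName ` K' \<and> weak C (CCo K') C' \<and> C' \<Turnstile> \<phi>)"
  by pat_completeness auto
termination
  by (relation "inv_image {(\<psi>, \<phi>). immediate \<psi> \<phi>} snd")
    (auto simp: wfp_immediate wfp_def[symmetric] intro: immediate.intros)

definition logic :: "('a, 'n, 'x) config \<Rightarrow> ('a, 'x, 'i) fml set" where
  "logic C = {\<phi>. closed_formula \<phi> \<and> C \<Turnstile> \<phi>}"

end

theory Submission
  imports Defs "HOL-Combinatorics.Transposition"
begin

text \<open>
  Bisimilar configurations satisfy the same formulae by induction on formulae; a witnessing cofinite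
  set of names is shrunk by the finitely many names that are not fresh for the other configuration.

  Conversely, call two configurations equivalent if they agree on the closed formulae whose names
  all occur in the history of one of the two. This restriction makes equivalence a bisimulation:
  weak transitions change the external names only by adding the name of the label, so a move by
  \<open>k(a)\<close> that has no equivalent answer is refuted by a conjunction \<open>\<phi>\<close> with finitely many names,
  and \<open>k\<close> is the only one that is not a name of the original configurations. The formula
  \<open>\<langle>x(a)\<rangle>\<phi>[x/k]\<close> then separates these, because transitions and satisfaction are invariant under
  swapping \<open>k\<close> with any other fresh name \<open>l\<close>. Formulae with infinitely many names would not do:
  \<open>k\<close> could not be swapped with a name that does not occur in them.
\<close>

section \<open>Transitions under injective renamings of transaction names\<close>

text \<open>The generated rule states the hypothesis for sums through set functions of options and
  pairs over the range of \<open>F\<close>. This form speaks of the summands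
  \<open>F i = Some (\<mu>, P)\<close> directly.\<close>

lemma proc_induct [case_names Sum Par Res PVar Rec Run Co Dormant, induct type: proc]:
  assumes "\<And>F. (\<And>i \<mu> P. F i = Some (\<mu>, P) \<Longrightarrow> \<Phi> P) \<Longrightarrow> \<Phi> (Sum F)"
    and "\<And>P Q. \<Phi> P \<Longrightarrow> \<Phi> Q \<Longrightarrow> \<Phi> (Par P Q)"
    and "\<And>P. \<Phi> P \<Longrightarrow> \<Phi> (Res P)"
    and "\<And>X. \<Phi> (PVar X)"
    and "\<And>X P. \<Phi> P \<Longrightarrow> \<Phi> (Rec X P)"
    and "\<And>P k Q. \<Phi> P \<Longrightarrow> \<Phi> Q \<Longrightarrow> \<Phi> (Run P k Q)"
    and "\<Phi> Co"
    and "\<And>P Q. \<Phi> P \<Longrightarrow> \<Phi> Q \<Longrightarrow> \<Phi> (Dormant P Q)"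
  shows "\<Phi> P"
proof (induction P rule: proc.induct)
  case (Sum F)
  show ?case
    by (rule assms(1), rule Sum[OF rangeI]) (auto simp: prod_set_defs)
qed (rule assms; assumption)+

section \<open>Renaming of transaction names against the other operations on terms\<close>

lemma map_trn_Sum_Some:
  "(map_option (map_prod id (map_trn f)) \<circ> F) i = Some (\<mu>, Q) \<longleftrightarrow>
    (\<exists>P. F i = Some (\<mu>, P) \<and> Q = map_trn f P)"
  by auto

lemma map_trn_ren: "map_trn f (ren P r) = ren (map_trn f P) r"
proof (induction P arbitrary: r)
  case (Sum F)
  show ?case
    by (auto simp: fun_eq_iff option.map_comp intro!: option.map_cong0 Sum elim!: option.set_cases)
qed auto

lemma map_trn_psubst:
  "map_trn f (psubst P X R) = psubst (map_trn f P) X (map_trn f R)"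
proof (induction P arbitrary: R)
  case (Sum F)
  show ?case
    by (auto simp: fun_eq_iff option.map_comp intro!: option.map_cong0 Sum elim!: option.set_cases)
qed (auto simp: map_trn_ren)

text \<open>Injectivity keeps names outside the domain of \<open>\<sigma>\<close> outside the domain
  of the renamed substitution.\<close>

lemma app_sub_map_nsub: "inj f \<Longrightarrow> app_sub (map_nsub f \<sigma>) (f k) = f (app_sub \<sigma> k)"
  by (cases \<sigma>) (auto dest: injD)

lemma map_trn_sub_proc:
  "inj f \<Longrightarrow> map_trn f (sub_proc P \<sigma>) = sub_proc (map_trn f P) (map_nsub f \<sigma>)"
  by (simp add: proc.map_comp o_def app_sub_map_nsub)

lemma range_sub_map_nsub: "range_sub (map_nsub f \<sigma>) = f ` range_sub \<sigma>"
  by (cases \<sigma>) auto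

lemma dom_sub_map_nsub: "dom_sub (map_nsub f \<sigma>) = f ` dom_sub \<sigma>"
  by (cases \<sigma>) auto

text \<open>Injectivity preserves the negative side conditions: \<open>k\<close> and
  \<open>l\<close> stay distinct when a running transaction changes its name, and the range of
  \<open>\<sigma>\<close> stays fresh for the parallel context.\<close>

lemma ptrans_map_trn:
  assumes "inj f"
  shows "ptrans P \<alpha> \<sigma> P' \<Longrightarrow>
    ptrans (map_trn f P) (map_label id f \<alpha>) (map_nsub f \<sigma>) (map_trn f P')"
proof (induction rule: ptrans.induct)
  case (1 F j \<mu> P)
  then show ?case by (auto intro!: ptrans.intros(1)[of _ j] simp: pre.map_ident)
next
  case (3 X P)
  then show ?case using ptrans.intros(3) by (simp add: map_trn_psubst)
next
  case (4 F j a P k)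
  then show ?case by (auto intro!: ptrans.intros(4)[of _ j, simplified] simp: act.map_id act.map_ident)
next
  case (5 P \<mu> P' k l Q)
  then show ?case using assms by (auto intro!: ptrans.intros simp: inj_eq)
next
  case (6 P k a \<sigma>1 P' Q \<sigma>2 Q' ls1 ls2)
  then show ?case
    using ptrans.intros(6)[of "map_trn f P" "f k" a "map_nsub f \<sigma>1" "map_trn f P'"
        "map_trn f Q" "map_nsub f \<sigma>2" "map_trn f Q'"]
    by (simp add: map_trn_sub_proc[OF assms] act.map_id act.map_ident)
next
  case (7 P \<alpha> \<sigma> P' Q)
  then have "range_sub (map_nsub f \<sigma>) \<inter> ftn (map_trn f Q) = {}"
    using assms by (auto simp: range_sub_map_nsub proc.set_map inj_eq)
  with 7 show ?case by (auto simp: map_trn_sub_proc[OF assms] intro: ptrans.intros)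
next
  case (8 P \<alpha> \<sigma> P' Q)
  then have "range_sub (map_nsub f \<sigma>) \<inter> ftn (map_trn f Q) = {}"
    using assms by (auto simp: range_sub_map_nsub proc.set_map inj_eq)
  with 8 show ?case by (auto simp: map_trn_sub_proc[OF assms] intro: ptrans.intros)
next
  case (9 P \<alpha> \<sigma> P')
  then show ?case by (auto intro!: ptrans.intros simp: label.map_comp o_def id_def)
qed (auto intro: ptrans.intros simp: act.map_id act.map_ident)

text \<open>No rule of structural congruence has a side condition on transaction names, so
  \<open>f\<close> may be arbitrary. For sums the index bijection is reused, since renaming does not
  change the domain.\<close>

lemma scong_map_trn: "scong P Q \<Longrightarrow> scong (map_trn f P) (map_trn f Q)"
proof (induction rule: scong.induct)
  case (10 \<pi> F G)
  show ?case
    unfolding proc.map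
  proof (rule scong.intros(10)[of \<pi>])
    show "bij_betw \<pi> (dom (map_option (map_prod id (map_trn f)) \<circ> F))
       (dom (map_option (map_prod id (map_trn f)) \<circ> G))"
      using 10(1) by (simp add: dom_def)
  qed (use 10 in fastforce)
qed (auto intro: scong.intros simp: map_trn_ren o_def)

lemma co_red_map_trn: "co_red P Q \<Longrightarrow> co_red (map_trn f P) (map_trn f Q)"
  by (induction rule: co_red.induct) (auto intro: co_red.intros simp: o_def)

lemma rname_map_rlabel: "rname (map_rlabel f \<beta>) = f (rname \<beta>)"
  by (cases \<beta>) auto

text \<open>Injectivity serves the freshness condition on the idle side of a parallel
  composition.\<close>

lemma rtrans_map_trn:
  assumes "inj f"
  shows "rtrans P \<beta> P' \<Longrightarrow> rtrans (map_trn f P) (map_rlabel f \<beta>) (map_trn f P')"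
proof (induction rule: rtrans.induct)
  case (1 P P'' P' Q k)
  then show ?case
    using scong_map_trn[of P "Par Co P''" f] co_red_map_trn[of P P' f]
    by (auto intro: rtrans.intros)
next
  case (4 \<beta> k P P' Q Q')
  then show ?case by (auto intro: rtrans.intros)
next
  case (5 P \<beta> P' Q)
  then show ?case
    using assms by (auto intro!: rtrans.intros simp: proc.set_map rname_map_rlabel inj_image_mem_iff)
next
  case (6 Q \<beta> Q' P)
  then show ?case
    using assms by (auto intro!: rtrans.intros simp: proc.set_map rname_map_rlabel inj_image_mem_iff)
qed (auto intro: rtrans.intros)

text \<open>Constructors are preserved by \<open>map_trn\<close>, so subterms of the renamed term
  can be traced back to the original one. This transfers the conditions of \<open>process\<close>,
  which quantify over subterms.\<close>

lemma subterm_map_trn_iff: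
  "subterm T (map_trn f P) \<longleftrightarrow> (\<exists>T'. T = map_trn f T' \<and> subterm T' P)"
proof
  show "subterm T (map_trn f P) \<Longrightarrow> \<exists>T'. T = map_trn f T' \<and> subterm T' P"
  proof (induction P)
    case (Sum F)
    from Sum.prems consider "T = map_trn f (Sum F)"
      | i \<mu> P where "F i = Some (\<mu>, P)" "subterm T (map_trn f P)"
      by (cases rule: subterm.cases) auto
    then show ?case
      using Sum.IH by cases (blast intro: subterm.intros)+
  qed (erule subterm.cases; force intro: subterm.intros)+
  have "subterm T' P \<Longrightarrow> subterm (map_trn f T') (map_trn f P)" for T'
  proof (induction rule: subterm.induct)
    case (2 F i \<mu> P T)
    then show ?case by (auto intro: subterm.intros(2)[of _ i])
  qed (auto intro: subterm.intros)
  then show "\<exists>T'. T = map_trn f T' \<and> subterm T' P \<Longrightarrow> subterm T (map_trn f P)" by blast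
qed

lemma free_var_map_trn: "free_var X (map_trn f P) \<longleftrightarrow> free_var X P"
proof
  show "free_var X (map_trn f P) \<Longrightarrow> free_var X P"
    by (induction P) (erule free_var.cases; fastforce intro: free_var.intros)+
  show "free_var X P \<Longrightarrow> free_var X (map_trn f P)"
  proof (induction rule: free_var.induct)
    case (2 F i \<mu> P X)
    then show ?case by (auto intro: free_var.intros(2)[of _ i])
  qed (auto intro: free_var.intros)
qed

lemma dangling_map_trn: "dangling n (map_trn f P) \<longleftrightarrow> dangling n P"
proof
  show "dangling n (map_trn f P) \<Longrightarrow> dangling n P"
    by (induction P arbitrary: n) (erule dangling.cases; fastforce intro: dangling.intros)+
  show "dangling n P \<Longrightarrow> dangling n (map_trn f P)"
  proof (induction rule: dangling.induct)
    case (1 F i \<mu> P n)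
    then show ?case by (auto intro: dangling.intros(1)[of _ i])
  next
    case (2 F i \<mu> P n)
    then show ?case by (auto intro: dangling.intros(2)[of _ i])
  qed (auto intro: dangling.intros)
qed

lemma no_dormant_map_trn:
  assumes "no_dormant P"
  shows "no_dormant (map_trn f P)"
  unfolding no_dormant_def subterm_map_trn_iff
proof (intro allI notI, elim exE conjE)
  fix Q R T
  assume "Dormant Q R = map_trn f T" "subterm T P"
  then show False
    using assms by (cases T) (auto simp: no_dormant_def)
qed

lemma closed_term_map_trn: "closed_term (map_trn f P) \<longleftrightarrow> closed_term P"
  by (simp add: closed_term_def free_var_map_trn)

lemma process_map_trn:
  assumes "process P"
  shows "process (map_trn f P)"
proof -
  have run: "ftn P1 = {} \<and> ftn P1' = {} \<and> no_dormant P1 \<and> closed_term P1"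
    if "subterm (Run P1 k P1') (map_trn f P)" for P1 k P1'
  proof -
    from that obtain T where "Run P1 k P1' = map_trn f T" "subterm T P"
      by (auto simp: subterm_map_trn_iff)
    then show ?thesis
      using assms
      by (cases T) (auto simp: process_def proc.set_map no_dormant_map_trn closed_term_map_trn)
  qed
  have dormant: "ftn P2 = {} \<and> ftn P2' = {} \<and> no_dormant P2 \<and> closed_term P2"
    if "subterm (Dormant P2 P2') (map_trn f P)" for P2 P2'
  proof -
    from that obtain T where "Dormant P2 P2' = map_trn f T" "subterm T P"
      by (auto simp: subterm_map_trn_iff)
    then show ?thesis
      using assms
      by (cases T) (auto simp: process_def proc.set_map no_dormant_map_trn closed_term_map_trn)
  qed
  have sum: "ftn Q = {} \<and> no_dormant Q"
    if "subterm (Sum F) (map_trn f P)" "F i = Some (\<mu>, Q)" for F i \<mu> Q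
  proof -
    from that obtain T where T: "Sum F = map_trn f T" "subterm T P"
      by (auto simp: subterm_map_trn_iff)
    then obtain G where G: "T = Sum G" "F = map_option (map_prod id (map_trn f)) \<circ> G"
      by (cases T) auto
    with that obtain Q' where "G i = Some (\<mu>, Q')" "Q = map_trn f Q'"
      by (auto simp: map_trn_Sum_Some)
    moreover from this have "ftn Q' = {}" "no_dormant Q'"
      using assms T(2) G(1) unfolding process_def by blast+
    ultimately show ?thesis
      by (simp add: proc.set_map no_dormant_map_trn)
  qed
  have recs: "ftn R = {}" if "subterm (Rec X R) (map_trn f P)" for X R
  proof -
    from that obtain T where "Rec X R = map_trn f T" "subterm T P"
      by (auto simp: subterm_map_trn_iff)
    then show ?thesis
      using assms by (cases T) (auto simp: process_def proc.set_map)
  qed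
  have "\<not> dangling n (map_trn f P)" for n
    using assms by (simp add: process_def dangling_map_trn)
  moreover have "closed_term (map_trn f P)" "finite (ftn (map_trn f P))"
    using assms by (simp_all add: process_def closed_term_map_trn proc.set_map)
  ultimately show ?thesis
    unfolding process_def using run dormant sum recs by (intro conjI allI impI) blast+
qed

section \<open>Configurations under renamings of external names\<close>

text \<open>Internal names stay fixed, since neither labels of configuration transitions nor
  formulae mention them. The qualified \<open>trn.map_trn\<close> is the map of the datatype of
  names, plain \<open>map_trn\<close> that of processes.\<close>

abbreviation ext_map :: "('x \<Rightarrow> 'y) \<Rightarrow> ('n, 'x) trn \<Rightarrow> ('n, 'y) trn" where
  "ext_map g \<equiv> trn.map_trn id g"

abbreviation rel_map :: "('k \<Rightarrow> 'l) \<Rightarrow> ('k \<times> 'k) set \<Rightarrow> ('l \<times> 'l) set" where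
  "rel_map f E \<equiv> map_prod f f ` E"

abbreviation hist_map ::
  "('x \<Rightarrow> 'y) \<Rightarrow> (nat \<Rightarrow> ('a, 'x) hist option) \<Rightarrow> nat \<Rightarrow> ('a, 'y) hist option" where
  "hist_map g H \<equiv> (\<lambda>i. map_option (map_hist id g) (H i))"

fun conf_map :: "('x \<Rightarrow> 'y) \<Rightarrow> ('a, 'n, 'x) config \<Rightarrow> ('a, 'n, 'y) config" where
  "conf_map g (Conf E H P) =
     Conf (rel_map (ext_map g) E) (hist_map g H) (map_trn (ext_map g) P)"

section \<open>Injective renamings of relations and histories\<close>

lemma inj_ext_map: "inj g \<Longrightarrow> inj (ext_map g)"
  by (rule trn.inj_map) auto

lemma bij_ext_map:
  assumes "bij g"
  shows "bij (ext_map g)"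
proof (rule bijI)
  show "surj (ext_map g)"
  proof (rule surjI)
    show "ext_map g (ext_map (inv g) y) = y" for y :: "('n, 'b) trn"
      using assms by (cases y) (auto simp: bij_is_surj surj_f_inv_f)
  qed
qed (use assms in \<open>simp add: bij_is_inj inj_ext_map\<close>)

lemma ext_map_eq_External_iff: "ext_map g k = External l \<longleftrightarrow> (\<exists>k'. k = External k' \<and> l = g k')"
  by (cases k) auto

lemma mem_rel_map_iff: "inj f \<Longrightarrow> (f x, f y) \<in> rel_map f E \<longleftrightarrow> (x, y) \<in> E"
  by (auto simp: inj_eq)

lemma Field_rel_map: "Field (rel_map f E) = f ` Field E"
  by (auto simp: Field_def Domain.simps Range.simps image_iff)

text \<open>Reflexivity, symmetry and transitivity pass both ways along an injection. The backward
  direction lets \<open>sub_equiv_rel_map\<close> recognise preimages of candidate relations as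
  candidates.\<close>

lemma equiv_rel_map:
  assumes "inj f"
  shows "equiv (Field (rel_map f E)) (rel_map f E) \<longleftrightarrow> equiv (Field E) E"
proof
  assume eq: "equiv (Field E) E"
  show "equiv (Field (rel_map f E)) (rel_map f E)"
  proof (rule equivI)
    show "refl_on (Field (rel_map f E)) (rel_map f E)"
      using eq by (auto simp: equiv_def refl_on_def Field_rel_map)
    show "sym (rel_map f E)"
      using eq by (auto simp: equiv_def sym_def)
    show "trans (rel_map f E)"
    proof (rule transI)
      fix x y z assume "(x, y) \<in> rel_map f E" "(y, z) \<in> rel_map f E"
      then obtain x' y' z' where "x = f x'" "z = f z'" "(x', y') \<in> E" "(y', z') \<in> E"
        using assms by (auto dest: injD)
      then show "(x, z) \<in> rel_map f E"
        using eq by (auto simp: equiv_def dest: transD)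
    qed
  qed (auto intro: FieldI1 FieldI2)
next
  assume eq: "equiv (Field (rel_map f E)) (rel_map f E)"
  note mem = mem_rel_map_iff[OF assms, of _ _ E]
  show "equiv (Field E) E"
  proof (rule equivI)
    show "refl_on (Field E) E"
    proof (rule refl_onI)
      fix x assume "x \<in> Field E"
      then have "f x \<in> Field (rel_map f E)"
        by (simp add: Field_rel_map)
      then show "(x, x) \<in> E"
        using eq mem[of x x] unfolding equiv_def by (metis refl_onD)
    qed
    show "sym E"
    proof (rule symI)
      fix x y assume "(x, y) \<in> E"
      then show "(y, x) \<in> E"
        using eq mem[of x y] mem[of y x] symD[of "rel_map f E" "f x" "f y"] by (simp add: equiv_def)
    qed
    show "trans E"
    proof (rule transI)
      fix x y z assume "(x, y) \<in> E" "(y, z) \<in> E"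
      then show "(x, z) \<in> E"
        using eq mem[of x y] mem[of y z] mem[of x z]
          transD[of "rel_map f E" "f x" "f y" "f z"] by (simp add: equiv_def)
    qed
  qed (auto intro: FieldI1 FieldI2)
qed

text \<open>A bijection matches the candidate relations over the two name types one to one, and its
  images commute with intersections; hence the least candidates match too.\<close>

lemma sub_equiv_rel_map:
  fixes f :: "'k \<Rightarrow> 'l"
  assumes "bij f"
  shows "sub_equiv (map_nsub f \<sigma>) (rel_map f E) = rel_map f (sub_equiv \<sigma> E)"
proof -
  \<comment> \<open>\<open>good\<close> and \<open>good'\<close> are one predicate at the two name
    types; a local definition is monomorphic in them.\<close>
  define good where "good \<sigma> E F \<longleftrightarrow> equiv (Field F) F \<and> E \<subseteq> F \<and>
     (\<forall>l \<in> range_sub \<sigma>. (l, l) \<in> F \<and> (\<forall>k \<in> dom_sub \<sigma>. (k, l) \<in> F))"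
    for \<sigma> and E F :: "('k \<times> 'k) set"
  define good' where "good' \<sigma> E F \<longleftrightarrow> equiv (Field F) F \<and> E \<subseteq> F \<and>
     (\<forall>l \<in> range_sub \<sigma>. (l, l) \<in> F \<and> (\<forall>k \<in> dom_sub \<sigma>. (k, l) \<in> F))"
    for \<sigma> and E F :: "('l \<times> 'l) set"
  have "inj f" using assms by (rule bij_is_inj)
  have bij: "bij (map_prod f f)"
    using assms by (simp add: bij_def prod.inj_map map_prod_surj)
  have good: "good' (map_nsub f \<sigma>) (rel_map f E) (rel_map f F) \<longleftrightarrow> good \<sigma> E F" for F
    unfolding good_def good'_def range_sub_map_nsub dom_sub_map_nsub ball_simps
      equiv_rel_map[OF \<open>inj f\<close>] mem_rel_map_iff[OF \<open>inj f\<close>]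
      inj_image_subset_iff[OF bij_is_inj[OF bij]] ..
  have "{F. good' (map_nsub f \<sigma>) (rel_map f E) F} = image (map_prod f f) ` {F. good \<sigma> E F}"
  proof (intro equalityI subsetI)
    fix F assume F: "F \<in> {F. good' (map_nsub f \<sigma>) (rel_map f E) F}"
    \<comment> \<open>By surjectivity, every candidate is the image of its preimage.\<close>
    have eq: "F = rel_map f (map_prod f f -` F)"
      using bij by (simp add: bij_is_surj surj_image_vimage_eq)
    with F good have "good \<sigma> E (map_prod f f -` F)"
      by (metis mem_Collect_eq)
    then show "F \<in> image (map_prod f f) ` {F. good \<sigma> E F}"
      using eq by (intro image_eqI[of _ _ "map_prod f f -` F"] CollectI)
  next
    fix F assume "F \<in> image (map_prod f f) ` {F. good \<sigma> E F}"
    then obtain F' where "F = rel_map f F'" "good \<sigma> E F'"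
      by blast
    then show "F \<in> {F. good' (map_nsub f \<sigma>) (rel_map f E) F}"
      unfolding mem_Collect_eq by (simp only: good)
  qed
  then show ?thesis
    unfolding sub_equiv_def good_def[symmetric] good'_def[symmetric]
    using bij_image_INT[OF bij, of "\<lambda>F. F" "{F. good \<sigma> E F}"] by simp
qed

lemma hname_map_hist: "hname (map_hist f g h) = g (hname h)"
  by (cases h) auto

lemma htrn_hist_map: "htrn (hist_map g H) = g ` htrn H"
  by (auto simp: htrn_def ran_def image_Collect hname_map_hist) (metis hname_map_hist)+

lemma hasco_hist_map: "inj g \<Longrightarrow> hasco (hist_map g H) = g ` hasco H"
proof -
  have "map_hist id g h = HCo k \<longleftrightarrow> (\<exists>k'. h = HCo k' \<and> k = g k')" for h :: "('c, 'a) hist" and k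
    by (cases h) auto
  then show ?thesis
    by (auto simp: hasco_def)
qed

lemma delta_names_map:
  "delta_names (rel_map (ext_map g) E) (hist_map g H) = ext_map g ` delta_names E H"
  by (auto simp: delta_names_def Field_rel_map htrn_hist_map image_Un image_image)

lemma ext_class_map:
  assumes "inj g"
  shows "ext_class (rel_map (ext_map g) E) (ext_map g k) = g ` ext_class E k"
proof (intro equalityI subsetI)
  fix l assume "l \<in> ext_class (rel_map (ext_map g) E) (ext_map g k)"
  then obtain x y where xy: "(x, y) \<in> E" "ext_map g k = ext_map g x" "External l = ext_map g y"
    by (auto simp: ext_class_def)
  then have "k = x"
    using injD[OF inj_ext_map[OF assms]] by blast
  moreover obtain l' where "y = External l'" "l = g l'"
    using xy(3) ext_map_eq_External_iff by metis
  ultimately show "l \<in> g ` ext_class E k"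
    using xy(1) by (simp add: ext_class_def)
next
  fix l assume "l \<in> g ` ext_class E k"
  then obtain l' where "l = g l'" "(k, External l') \<in> E"
    by (auto simp: ext_class_def)
  then show "l \<in> ext_class (rel_map (ext_map g) E) (ext_map g k)"
    using mem_rel_map_iff[OF inj_ext_map[OF assms], of k "External l'" E]
    by (simp add: ext_class_def)
qed

text \<open>The hypothesis on \<open>r\<close> and \<open>r'\<close> holds for \<open>HCo\<close>
  and for \<open>HAb\<close>, so commits and aborts are treated at once.\<close>

lemma resolve_map:
  assumes "inj g" and "\<And>k. map_hist id g (r k) = r' (g k)"
  shows "resolve r' (rel_map (ext_map g) E) (ext_map g k) (hist_map g H) =
    hist_map g (resolve r E k H)"
proof
  fix i
  have *: "(External (g k'), ext_map g k) \<in> rel_map (ext_map g) E \<longleftrightarrow> (External k', k) \<in> E" for k'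
    using mem_rel_map_iff[OF inj_ext_map[OF assms(1)], of "External k'" k E] by simp
  show "resolve r' (rel_map (ext_map g) E) (ext_map g k) (hist_map g H) i =
    hist_map g (resolve r E k H) i"
    by (auto simp: resolve_def * assms(2) split: option.splits hist.splits)
qed

lemma ext_config_conf_map:
  fixes g :: "'x \<Rightarrow> 'y" and C :: "('a, 'n, 'x) config"
  assumes "inj g" "ext_config C"
  shows "ext_config (conf_map g C)"
proof (cases C)
  case (Conf E H P)
  let ?p = "ext_map g :: ('n, 'x) trn \<Rightarrow> ('n, 'y) trn"
  note inj = inj_ext_map[OF assms(1)]
  \<comment> \<open>Since \<open>ext_map g\<close> preserves constructors, an external name in a
    renamed pair has an external origin.\<close>
  have mem: "(x, External k) \<in> rel_map ?p E \<longleftrightarrow> (\<exists>x' k'. x = ?p x' \<and> k = g k' \<and> (x', External k') \<in> E)"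
    for x k
  proof
    assume "(x, External k) \<in> rel_map ?p E"
    then obtain x' y' where *: "(x', y') \<in> E" "x = ?p x'" "External k = ?p y'"
      by auto
    then show "\<exists>x' k'. x = ?p x' \<and> k = g k' \<and> (x', External k') \<in> E"
      by (metis ext_map_eq_External_iff)
  next
    assume "\<exists>x' k'. x = ?p x' \<and> k = g k' \<and> (x', External k') \<in> E"
    then obtain x' k' where "x = ?p x'" "k = g k'" "(x', External k') \<in> E"
      by blast
    then show "(x, External k) \<in> rel_map ?p E"
      using mem_rel_map_iff[OF inj, of x' "External k'" E] by simp
  qed
  have ext: "External l = ?p k \<longleftrightarrow> (\<exists>k'. k = External k' \<and> l = g k')" for k l
    by (cases k) auto
  have "process P" "finite (Field E)" "equiv (Field E) E" "finite (dom H)"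
    "\<forall>i j h h'. H i = Some h \<longrightarrow> H j = Some h' \<longrightarrow> hname h = hname h' \<longrightarrow> i = j"
    "\<forall>k. (External k, External k) \<in> E \<longleftrightarrow> k \<in> htrn H"
    "\<forall>k k'. (External k, External k') \<in> E \<longrightarrow> (k \<in> hasco H \<longleftrightarrow> k' \<in> hasco H)"
    "ftn P \<inter> External ` hasco H = {}"
    "\<forall>k k'. (k, k') \<in> E \<longrightarrow> k \<in> ftn P \<longrightarrow> k' \<in> ftn P \<longrightarrow> k = k'"
    "ftn P \<inter> range External \<subseteq> External ` htrn H"
    using assms(2) unfolding Conf ext_config.simps by - ((elim conjE)?, assumption)+
  \<comment> \<open>The ten conditions on an extended configuration, used below by their
    position.\<close>
  note C = this[rule_format]
  let ?E = "rel_map ?p E" and ?H = "hist_map g H" and ?P = "map_trn ?p P"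
  have process: "process ?P"
    using C(1) by (rule process_map_trn)
  have finite_E: "finite (Field ?E)"
    using C(2) by (simp add: Field_rel_map)
  have equiv: "equiv (Field ?E) ?E"
    using C(3) by (simp only: equiv_rel_map[OF inj])
  have finite_H: "finite (dom ?H)"
    using C(4) by (simp add: dom_def)
  have inj_H: "\<forall>i j h h'. ?H i = Some h \<longrightarrow> ?H j = Some h' \<longrightarrow> hname h = hname h' \<longrightarrow> i = j"
    using C(5) assms(1) by (auto simp: hname_map_hist inj_eq)
  have names: "\<forall>k. (External k, External k) \<in> ?E \<longleftrightarrow> k \<in> htrn ?H"
  proof
    fix k
    have "(External k, External k) \<in> ?E \<longleftrightarrow> (\<exists>k'. k = g k' \<and> (External k', External k') \<in> E)"
      unfolding mem using assms(1) by (auto simp: ext inj_eq)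
    then show "(External k, External k) \<in> ?E \<longleftrightarrow> k \<in> htrn ?H"
      using C(6) by (auto simp: htrn_hist_map)
  qed
  have committed: "\<forall>k k'. (External k, External k') \<in> ?E \<longrightarrow> (k \<in> hasco ?H \<longleftrightarrow> k' \<in> hasco ?H)"
  proof (intro allI impI)
    fix k k' assume "(External k, External k') \<in> ?E"
    then obtain l l' where "k = g l" "k' = g l'" "(External l, External l') \<in> E"
      unfolding mem ext by blast
    then show "k \<in> hasco ?H \<longleftrightarrow> k' \<in> hasco ?H"
      using C(7) assms(1) by (simp add: hasco_hist_map inj_image_mem_iff)
  qed
  have "External ` hasco ?H = ?p ` External ` hasco H"
    using assms(1) by (simp add: hasco_hist_map image_image)
  then have disjoint: "ftn ?P \<inter> External ` hasco ?H = {}"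
    using C(8) by (metis image_Int[OF inj] image_empty proc.set_map)
  have related: "\<forall>k k'. (k, k') \<in> ?E \<longrightarrow> k \<in> ftn ?P \<longrightarrow> k' \<in> ftn ?P \<longrightarrow> k = k'"
  proof (intro allI impI)
    fix k k' assume "(k, k') \<in> ?E" and ftn: "k \<in> ftn ?P" "k' \<in> ftn ?P"
    then obtain l l' where "k = ?p l" "k' = ?p l'" "(l, l') \<in> E"
      by auto
    then show "k = k'"
      using ftn C(9)[of l l'] by (simp add: proc.set_map inj_image_mem_iff[OF inj])
  qed
  have "ftn ?P \<inter> range External \<subseteq> External ` htrn ?H"
  proof
    fix k assume k: "k \<in> ftn ?P \<inter> range External"
    then obtain l where l: "l \<in> ftn P" "k = ?p l"
      by (auto simp: proc.set_map)
    moreover have "l \<in> range External"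
      using k l(2) by (cases l) auto
    ultimately show "k \<in> External ` htrn ?H"
      using C(10) by (auto simp: htrn_hist_map)
  qed
  then show ?thesis
    unfolding Conf conf_map.simps ext_config.simps
    by (intro conjI process finite_E equiv finite_H inj_H names committed disjoint related)
qed

text \<open>The history suffices: for extended configurations the relation and the process
  contribute no further external names, see \<open>ext_config_ext_names\<close>.\<close>

fun ext_names :: "('a, 'n, 'x) config \<Rightarrow> 'x set" where
  "ext_names (Conf E H P) = htrn H"

lemma map_trn_idI: "(\<And>k. k \<in> ftn P \<Longrightarrow> f k = k) \<Longrightarrow> map_trn f P = P"
  using proc.map_cong[of P P f id] by (simp add: proc.map_id)

text \<open>An external name in the field of \<open>E\<close> is related to itself by reflexivity
  and so occurs in the history; the names of \<open>P\<close> are covered by the convention.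
  Freshness of an external name thus becomes absence from a finite set.\<close>

lemma ext_config_ext_names:
  assumes "ext_config C"
  shows "External k \<in> config_names C \<longleftrightarrow> k \<in> ext_names C" "finite (ext_names C)"
proof -
  obtain E H P where Conf: "C = Conf E H P"
    by (cases C)
  have "equiv (Field E) E" "finite (dom H)"
    "\<forall>k. (External k, External k) \<in> E \<longleftrightarrow> k \<in> htrn H"
    "ftn P \<inter> range External \<subseteq> External ` htrn H"
    using assms unfolding Conf ext_config.simps by - ((elim conjE)?, assumption)+
  note C = this[rule_format]
  have "External k \<in> Field E \<longleftrightarrow> k \<in> htrn H"
    using C(1) C(3)[of k] by (auto simp: equiv_def refl_on_def Field_def)
  then show "External k \<in> config_names C \<longleftrightarrow> k \<in> ext_names C"
    using C(4) by (auto simp: Conf delta_names_def)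
  show "finite (ext_names C)"
    using C(2) by (simp add: Conf htrn_def finite_ran)
qed

text \<open>In particular, a swap of two names that are fresh for \<open>C\<close> leaves
  \<open>C\<close> unchanged.\<close>

lemma conf_map_ident:
  assumes "ext_config C" and "\<And>k. k \<in> ext_names C \<Longrightarrow> g k = k"
  shows "conf_map g C = C"
proof (cases C)
  case (Conf E H P)
  have id: "ext_map g k = k" if "k \<in> config_names C" for k
    using that assms(2) by (cases k) (auto simp: ext_config_ext_names(1)[OF assms(1)])
  have "map_prod (ext_map g) (ext_map g) p = p" if "p \<in> E" for p
    using that id unfolding Conf
    by (cases p) (auto simp: delta_names_def Field_def Domain_iff Range_iff)
  then have "rel_map (ext_map g) E = E"
    by force
  moreover have "hist_map g H = H"
  proof
    fix i
    have "map_hist id g h = h" if "H i = Some h" for h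
    proof -
      have "hname h \<in> htrn H"
        using that by (auto simp: htrn_def ran_def)
      then show ?thesis
        using assms(2) unfolding Conf by (cases h) (auto simp: act.map_id)
    qed
    then show "hist_map g H i = H i"
      by (cases "H i") auto
  qed
  moreover have "map_trn (ext_map g) P = P"
    by (rule map_trn_idI) (simp add: id Conf)
  ultimately show ?thesis
    by (simp add: Conf)
qed

fun clabel_map :: "('x \<Rightarrow> 'y) \<Rightarrow> ('a, 'x) clabel \<Rightarrow> ('a, 'y) clabel" where
  "clabel_map g CTau = CTau"
| "clabel_map g (CAct k a) = CAct (g k) a"
| "clabel_map g (CCo K) = CCo (g ` K)"

lemma clabel_map_eq_CTau_iff: "clabel_map g \<zeta> = CTau \<longleftrightarrow> \<zeta> = CTau"
  by (cases \<zeta>) auto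

lemma hist_map_upd: "hist_map g (H(i \<mapsto> h)) = (hist_map g H)(i \<mapsto> map_hist id g h)"
  by auto

text \<open>Freshness and external classes transfer along the injection, and the merged relation by
  \<open>sub_equiv_rel_map\<close>, which asks for a bijection.\<close>

lemma crule_conf_map:
  fixes g :: "'x \<Rightarrow> 'y"
  assumes "bij g"
  shows "crule C \<zeta> C' \<Longrightarrow> crule (conf_map g C) (clabel_map g \<zeta>) (conf_map g C')"
proof (induction rule: crule.induct)
  let ?p = "ext_map g :: ('n, 'x) trn \<Rightarrow> ('n, 'y) trn"
  note inj = bij_is_inj[OF assms]
  note inj' = inj_ext_map[OF inj]
  note sub = sub_equiv_rel_map[OF bij_ext_map[OF assms], symmetric]
  have fresh: "?p k \<notin> delta_names (rel_map ?p E) (hist_map g H) \<longleftrightarrow> k \<notin> delta_names E H"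
    for k E and H :: "nat \<Rightarrow> ('a, 'x) hist option"
    by (simp add: delta_names_map inj_image_mem_iff[OF inj'])
  have dom: "dom (hist_map g H) = dom H" for H :: "nat \<Rightarrow> ('a, 'x) hist option"
    by (simp add: dom_def)
  {
    case (1 P Q E H)
    then show ?case
      using ptrans_map_trn[OF inj' 1] by (auto intro!: crule.intros)
  next
    case (2 P k \<sigma> Q E H)
    then show ?case
      using ptrans_map_trn[OF inj' 2(1)] fresh[of "Internal k" E H]
      by (auto simp: sub intro!: crule.intros)
  next
    case (3 P k Q E H)
    then show ?case
      using rtrans_map_trn[OF inj' 3(1)] fresh[of "Internal k" E H]
      by (auto intro!: crule.intros(3))
  next
    case (4 P k Q E H)
    have "resolve HCo (rel_map ?p E) (?p k) (hist_map g H) = hist_map g (resolve HCo E k H)"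
      by (rule resolve_map[OF inj]) simp
    then show ?case
      using rtrans_map_trn[OF inj' 4(1)] ext_class_map[OF inj, of E k] 4(2)
        crule.intros(4)[of "map_trn ?p P" "?p k" "map_trn ?p Q" "rel_map ?p E" "hist_map g H"]
      by simp
  next
    case (5 P k Q E H)
    have "resolve HCo (rel_map ?p E) (?p k) (hist_map g H) = hist_map g (resolve HCo E k H)"
      by (rule resolve_map[OF inj]) simp
    then show ?case
      using rtrans_map_trn[OF inj' 5(1)] ext_class_map[OF inj, of E k] 5(2)
        crule.intros(5)[of "map_trn ?p P" "?p k" "map_trn ?p Q" "rel_map ?p E" "hist_map g H"]
      by simp
  next
    case (6 P k Q E H)
    have "resolve HAb (rel_map ?p E) (?p k) (hist_map g H) = hist_map g (resolve HAb E k H)"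
      by (rule resolve_map[OF inj]) simp
    then show ?case
      using rtrans_map_trn[OF inj' 6]
        crule.intros(6)[of "map_trn ?p P" "?p k" "map_trn ?p Q" "rel_map ?p E" "hist_map g H"]
      by simp
  next
    case (7 P k a \<sigma> Q E H i)
    then show ?case
      using ptrans_map_trn[OF inj' 7(1)] fresh[of "External k" E H]
        crule.intros(7)[of "map_trn ?p P" "g k" a "map_nsub ?p \<sigma>" "map_trn ?p Q"
          "rel_map ?p E" "hist_map g H" i]
      by (simp add: sub hist_map_upd dom act.map_id del: fun_upd_apply)
  next
    case (8 k E H i P)
    then show ?case
      using fresh[of "External k" E H]
        crule.intros(8)[of "g k" "rel_map ?p E" "hist_map g H" i "map_trn ?p P"]
      by (simp add: hist_map_upd dom del: fun_upd_apply)
  }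
qed

lemma cstep_conf_map:
  "bij g \<Longrightarrow> cstep C \<zeta> C' \<Longrightarrow> cstep (conf_map g C) (clabel_map g \<zeta>) (conf_map g C')"
  by (simp add: cstep_def crule_conf_map ext_config_conf_map bij_is_inj)

lemma tau_steps_conf_map:
  assumes "bij g"
  shows "tau_steps C C' \<Longrightarrow> tau_steps (conf_map g C) (conf_map g C')"
  unfolding tau_steps_def
proof (induction rule: rtranclp_induct)
  case (step C' C'')
  then show ?case
    using cstep_conf_map[OF assms step(2)] by (simp add: rtranclp.rtrancl_into_rtrancl)
qed simp

lemma weak_conf_map:
  assumes "bij g" "weak C \<zeta> C'"
  shows "weak (conf_map g C) (clabel_map g \<zeta>) (conf_map g C')"
  using assms(2) tau_steps_conf_map[OF assms(1)] cstep_conf_map[OF assms(1)]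
  unfolding weak_def clabel_map_eq_CTau_iff by (auto split: if_splits) blast

lemma conf_map_comp: "conf_map f (conf_map g C) = conf_map (f \<circ> g) C"
proof -
  have ext: "ext_map f \<circ> ext_map g = ext_map (f \<circ> g)"
    and hist: "map_hist id f \<circ> map_hist id g = map_hist id (f \<circ> g)"
    by (simp_all add: fun_eq_iff trn.map_comp hist.map_comp)
  show ?thesis
    by (cases C)
      (simp add: image_image prod.map_comp ext proc.map_comp option.map_comp hist)
qed

lemma conf_map_id: "conf_map id C = C"
  by (cases C) (simp add: trn.map_id0 proc.map_id hist.map_id0 option.map_id prod.map_id0)

lemma conf_map_inv:
  assumes "bij g"
  shows "conf_map g (conf_map (inv g) C) = C"
  using assms by (simp add: conf_map_comp conf_map_id bij_is_surj surj_iff[THEN iffD1])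

section \<open>External names along weak transitions\<close>

lemma htrn_eq: "htrn H = {k. \<exists>i. map_option hname (H i) = Some k}"
  by (auto simp: htrn_def ran_def image_iff)

text \<open>Resolving changes the constructor of an entry but neither its index nor its name, and
  \<open>htrn\<close> depends on the names alone.\<close>

lemma htrn_resolve:
  assumes "r = HCo \<or> r = HAb"
  shows "htrn (resolve r E k H) = htrn H"
proof -
  have "map_option hname (resolve r E k H i) = map_option hname (H i)" for i
    using assms by (auto simp: resolve_def split: option.splits hist.splits)
  then show ?thesis
    by (simp only: htrn_eq)
qed

text \<open>Only visible actions extend the history; commits and aborts rewrite existing
  entries.\<close>

fun clabel_new :: "('a, 'x) clabel \<Rightarrow> 'x set" where
  "clabel_new (CAct k a) = {k}"
| "clabel_new _ = {}"

lemma htrn_upd: "i \<notin> dom H \<Longrightarrow> htrn (H(i \<mapsto> h)) = insert (hname h) (htrn H)"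
  unfolding htrn_def by (simp add: domIff ran_map_upd)

lemma ext_names_crule: "crule C \<zeta> C' \<Longrightarrow> ext_names C' = clabel_new \<zeta> \<union> ext_names C"
  by (induction rule: crule.induct) (simp_all add: htrn_resolve htrn_upd del: fun_upd_apply)

lemma ext_names_tau_steps: "tau_steps C C' \<Longrightarrow> ext_names C' = ext_names C"
  unfolding tau_steps_def
  by (induction rule: rtranclp_induct) (auto simp: cstep_def dest!: ext_names_crule)

lemma ext_names_weak: "weak C \<zeta> C' \<Longrightarrow> ext_names C' = clabel_new \<zeta> \<union> ext_names C"
  unfolding weak_def cstep_def
  by (auto split: if_splits dest!: ext_names_tau_steps ext_names_crule)

lemma tau_steps_ext_config: "tau_steps C C' \<Longrightarrow> ext_config C \<Longrightarrow> ext_config C'"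
  unfolding tau_steps_def
  by (induction rule: rtranclp_induct) (auto simp: cstep_def)

lemma weak_ext_config: "weak C \<zeta> C' \<Longrightarrow> ext_config C \<Longrightarrow> ext_config C'"
  unfolding weak_def cstep_def by (auto split: if_splits dest: tau_steps_ext_config)

text \<open>Both rules for visible actions require freshness where the action happens, and the
  preceding silent steps do not change the external names.\<close>

lemma weak_CAct_fresh:
  assumes "weak C (CAct k a) C'"
  shows "k \<notin> ext_names C"
proof -
  from assms obtain D D' where D: "tau_steps C D" "crule D (CAct k a) D'"
    by (auto simp: weak_def cstep_def)
  from D(2) have "k \<notin> ext_names D"
    by (cases rule: crule.cases) (auto simp: delta_names_def)
  then show ?thesis
    using ext_names_tau_steps[OF D(1)] by simp
qed

text \<open>The commit rule demands a nonempty class, and members of a class lie in the field of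
  \<open>E\<close>. The modality for \<open>K\<close> is therefore well-formed and has its names in
  the history.\<close>

lemma weak_CCo:
  assumes "weak C (CCo K) C'"
  shows "K \<noteq> {}" "K \<subseteq> ext_names C"
proof -
  from assms obtain D D' where D: "tau_steps C D" "ext_config D" "crule D (CCo K) D'"
    by (auto simp: weak_def cstep_def)
  from D(3) obtain E H P k where Conf: "D = Conf E H P" and K: "K = ext_class E k" "K \<noteq> {}"
    by (cases rule: crule.cases) auto
  have "K \<subseteq> External -` config_names D"
    unfolding K Conf by (auto simp: ext_class_def delta_names_def intro: FieldI2)
  then show "K \<subseteq> ext_names C"
    using ext_config_ext_names(1)[OF D(2)] ext_names_tau_steps[OF D(1)] by auto
  show "K \<noteq> {}" by fact
qed

section \<open>Renaming and abstraction in formulae\<close>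

primrec tname_map :: "(nat \<Rightarrow> nat) \<Rightarrow> ('x \<Rightarrow> 'y) \<Rightarrow> 'x tname \<Rightarrow> 'y tname" where
  "tname_map v g (TName k) = TName (g k)"
| "tname_map v g (TVar x) = TVar (v x)"

text \<open>Bound variables are renamed by \<open>v\<close> as well; with an injective
  \<open>v\<close> this cannot cause capture.\<close>

primrec fml_rename :: "(nat \<Rightarrow> nat) \<Rightarrow> ('x \<Rightarrow> 'y) \<Rightarrow> ('a, 'x, 'i) fml \<Rightarrow> ('a, 'y, 'i) fml" where
  "fml_rename v g (DiaTau \<phi>) = DiaTau (fml_rename v g \<phi>)"
| "fml_rename v g (DiaAct x a \<phi>) = DiaAct (v x) a (fml_rename v g \<phi>)"
| "fml_rename v g (Neg \<phi>) = Neg (fml_rename v g \<phi>)"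
| "fml_rename v g (Conj F) = Conj (\<lambda>i. map_option (fml_rename v g) (F i))"
| "fml_rename v g (DiaCo K \<phi>) = DiaCo (tname_map v g ` K) (fml_rename v g \<phi>)"

primrec fml_names :: "('a, 'x, 'i) fml \<Rightarrow> 'x set" where
  "fml_names (DiaTau \<phi>) = fml_names \<phi>"
| "fml_names (DiaAct x a \<phi>) = fml_names \<phi>"
| "fml_names (Neg \<phi>) = fml_names \<phi>"
| "fml_names (Conj F) = (\<Union>i. \<Union> (set_option (map_option fml_names (F i))))"
| "fml_names (DiaCo K \<phi>) = TName -` K \<union> fml_names \<phi>"

text \<open>
  A formula may use every variable, so there need not be a fresh one to replace \<open>k\<close>. Shifting all
  variables, free and bound, frees the variable 0 for this and rules out capture; on closed formulae
  the shift is an alpha-conversion.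
\<close>

primrec tname_abstract :: "'x \<Rightarrow> 'x tname \<Rightarrow> 'x tname" where
  "tname_abstract k (TName l) = (if l = k then TVar 0 else TName l)"
| "tname_abstract k (TVar x) = TVar (Suc x)"

primrec fml_abstract :: "'x \<Rightarrow> ('a, 'x, 'i) fml \<Rightarrow> ('a, 'x, 'i) fml" where
  "fml_abstract k (DiaTau \<phi>) = DiaTau (fml_abstract k \<phi>)"
| "fml_abstract k (DiaAct x a \<phi>) = DiaAct (Suc x) a (fml_abstract k \<phi>)"
| "fml_abstract k (Neg \<phi>) = Neg (fml_abstract k \<phi>)"
| "fml_abstract k (Conj F) = Conj (\<lambda>i. map_option (fml_abstract k) (F i))"
| "fml_abstract k (DiaCo K \<phi>) = DiaCo (tname_abstract k ` K) (fml_abstract k \<phi>)"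

text \<open>As for processes, the case of conjunctions speaks of the conjuncts
  \<open>F i = Some \<phi>\<close> instead of set functions.\<close>

lemma fml_induct [case_names DiaTau DiaAct Neg Conj DiaCo, induct type: fml]:
  assumes "\<And>\<phi>. \<Phi> \<phi> \<Longrightarrow> \<Phi> (DiaTau \<phi>)"
    and "\<And>x a \<phi>. \<Phi> \<phi> \<Longrightarrow> \<Phi> (DiaAct x a \<phi>)"
    and "\<And>\<phi>. \<Phi> \<phi> \<Longrightarrow> \<Phi> (Neg \<phi>)"
    and "\<And>F. (\<And>i \<phi>. F i = Some \<phi> \<Longrightarrow> \<Phi> \<phi>) \<Longrightarrow> \<Phi> (Conj F)"
    and "\<And>K \<phi>. \<Phi> \<phi> \<Longrightarrow> \<Phi> (DiaCo K \<phi>)"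
  shows "\<Phi> \<phi>"
proof (induction \<phi> rule: fml.induct)
  case (Conj F)
  show ?case
    by (rule assms(4), rule Conj[OF rangeI]) auto
qed (rule assms; assumption)+

text \<open>An injective \<open>v\<close> identifies no other variable with \<open>x\<close>, so the
  same occurrences are replaced on both sides.\<close>

lemma fsubst_fml_rename:
  assumes "inj v"
  shows "fsubst (fml_rename v g \<phi>) (g l) (v x) = fml_rename v g (fsubst \<phi> l x)"
proof (induction \<phi>)
  case (Conj F)
  then show ?case
    by (auto simp: fun_eq_iff option.map_comp intro!: option.map_cong0 elim!: option.set_cases)
next
  case (DiaCo K \<phi>)
  have "(if tname_map v g t = TVar (v x) then TName (g l) else tname_map v g t) =
    tname_map v g (if t = TVar x then TName l else t)" for t
    using assms by (cases t) (auto dest: injD)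
  with DiaCo show ?case
    by (simp only: fsubst.simps fml_rename.simps image_image)
qed (use assms in \<open>auto dest: injD\<close>)

text \<open>Replaces, as a simplification rule, the recursive equation for conjunctions, which has
  to pass through \<open>map_option\<close>.\<close>

lemma fml_names_Conj: "l \<in> fml_names (Conj F) \<longleftrightarrow> (\<exists>i \<phi>. F i = Some \<phi> \<and> l \<in> fml_names \<phi>)"
  by (auto simp: option.set_map elim!: option.set_cases)

declare fml_names.simps(4) [simp del] fml_names_Conj [simp]

text \<open>Abstraction turns \<open>k\<close> into the variable 0, and the substitution turns this
  into \<open>l\<close>. No binder captures 0, since all original variables are shifted; and as
  \<open>l\<close> does not occur in \<open>\<phi>\<close>, swapping \<open>k\<close> and
  \<open>l\<close> amounts to replacing \<open>k\<close> by \<open>l\<close>.\<close>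

lemma fsubst_fml_abstract:
  "l \<notin> fml_names \<phi> \<Longrightarrow>
    fsubst (fml_abstract k \<phi>) l 0 = fml_rename Suc (transpose k l) \<phi>"
proof (induction \<phi>)
  case (Conj F)
  have "map_option (\<lambda>\<phi>. fsubst \<phi> l 0) (map_option (fml_abstract k) (F i)) =
    map_option (fml_rename Suc (transpose k l)) (F i)" for i
  proof (cases "F i")
    case (Some \<phi>)
    then have "l \<notin> fml_names \<phi>"
      using Conj.prems by auto
    with Some Conj.IH show ?thesis
      by simp
  qed simp
  then show ?case
    by simp
next
  case (DiaCo K \<phi>)
  have "(if tname_abstract k t = TVar 0 then TName l else tname_abstract k t) =
    tname_map Suc (transpose k l) t" if "t \<in> K" for t
    using that DiaCo.prems by (cases t) (auto simp: transpose_def)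
  moreover have "l \<notin> fml_names \<phi>"
    using DiaCo.prems by simp
  ultimately show ?case
    using DiaCo.IH
    by (simp only: not_False_eq_True simp_thms fsubst.simps fml_rename.simps fml_abstract.simps
        image_image cong: image_cong)
qed auto

section \<open>Well-formedness, free variables and names of abstracted formulae\<close>

lemma formula_fml_abstract: "formula \<phi> \<Longrightarrow> formula (fml_abstract k \<phi>)"
  by (induction rule: formula.induct) (auto intro: formula.intros)

inductive_cases free_in_DiaTauE: "free_in x (DiaTau \<phi>)"
inductive_cases free_in_DiaActE: "free_in x (DiaAct y a \<phi>)"
inductive_cases free_in_NegE: "free_in x (Neg \<phi>)"
inductive_cases free_in_ConjE: "free_in x (Conj F)"
inductive_cases free_in_DiaCoE: "free_in x (DiaCo K \<phi>)"

text \<open>The variable 0 stands for \<open>k\<close>, all others are shifted ones. After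
  abstraction in a closed formula only 0 can be free, and a binder for 0 closes the formula
  again.\<close>

lemma free_in_fml_abstract:
  "free_in x (fml_abstract k \<phi>) \<Longrightarrow> x = 0 \<or> (\<exists>y. x = Suc y \<and> free_in y \<phi>)"
proof (induction \<phi>)
  case (DiaTau \<phi>)
  then show ?case
    by (auto elim!: free_in_DiaTauE intro: free_in.intros)
next
  case (DiaAct y a \<phi>)
  then show ?case
    by (auto elim!: free_in_DiaActE intro: free_in.intros)
next
  case (Neg \<phi>)
  then show ?case
    by (auto elim!: free_in_NegE intro: free_in.intros)
next
  case (Conj F)
  from Conj.prems obtain i \<phi> where "F i = Some \<phi>" "free_in x (fml_abstract k \<phi>)"
    by (auto elim!: free_in_ConjE)
  with Conj.IH[of i \<phi>] show ?case
    by (auto intro: free_in.intros(4))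
next
  case (DiaCo K \<phi>)
  from DiaCo.prems consider "TVar x \<in> tname_abstract k ` K" | "free_in x (fml_abstract k \<phi>)"
    by (auto elim!: free_in_DiaCoE)
  then show ?case
  proof cases
    case 1
    then obtain t where "t \<in> K" "TVar x = tname_abstract k t"
      by auto
    then show ?thesis
      by (cases t) (auto intro: free_in.intros(5) split: if_splits)
  next
    case 2
    with DiaCo.IH show ?thesis
      by (auto intro: free_in.intros(6))
  qed
qed

text \<open>Removing \<open>k\<close> brings a separating formula back into the range of names on
  which \<open>agree\<close> compares configurations.\<close>

lemma fml_names_abstract: "fml_names (fml_abstract k \<phi>) \<subseteq> fml_names \<phi> - {k}"
proof (induction \<phi>)
  case (Conj F)
  show ?case
  proof
    fix l assume "l \<in> fml_names (fml_abstract k (Conj F))"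
    then obtain i \<phi> where "F i = Some \<phi>" "l \<in> fml_names (fml_abstract k \<phi>)"
      by auto
    with Conj[of i \<phi>] show "l \<in> fml_names (Conj F) - {k}"
      by auto
  qed
next
  case (DiaCo K \<phi>)
  have "l \<in> TName -` K \<and> l \<noteq> k" if "TName l = tname_abstract k t" "t \<in> K" for l t
    using that by (cases t) (auto split: if_splits)
  with DiaCo show ?case
    by auto
qed auto

text \<open>A bijective renaming can be undone, so weak transitions correspond in both directions.
  The induction follows \<open>immediate\<close> because the action modality refers to
  \<open>fsubst \<psi> l x\<close>, which is not a subformula.\<close>

lemma sat_conf_map:
  fixes \<phi> :: "('a, 'x, 'i) fml"
  assumes "bij g" "inj v"
  shows "conf_map g C \<Turnstile> fml_rename v g \<phi> \<longleftrightarrow> C \<Turnstile> \<phi>"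
proof (induction \<phi> arbitrary: C rule: wfp_induct_rule[OF wfp_immediate])
  case (1 \<phi>)
  note IH = 1
  \<comment> \<open>From left to right, the target is pulled back along
    \<open>inv g\<close>.\<close>
  have weak_iff: "(\<exists>D. weak (conf_map g C) (clabel_map g \<zeta>) D \<and> \<Psi> D) \<longleftrightarrow>
      (\<exists>D. weak C \<zeta> D \<and> \<Psi> (conf_map g D))" for \<zeta> \<Psi>
  proof
    assume "\<exists>D. weak (conf_map g C) (clabel_map g \<zeta>) D \<and> \<Psi> D"
    then obtain D where D: "weak (conf_map g C) (clabel_map g \<zeta>) D" "\<Psi> D"
      by blast
    have "inv g \<circ> g = id"
      using assms(1) by (simp add: bij_is_inj)
    moreover from this have "clabel_map (inv g) (clabel_map g \<zeta>) = \<zeta>"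
      by (cases \<zeta>) (auto simp: fun_eq_iff image_image)
    ultimately have "weak C \<zeta> (conf_map (inv g) D)"
      using weak_conf_map[OF bij_imp_bij_inv[OF assms(1)] D(1)]
      by (simp add: conf_map_comp conf_map_id)
    then show "\<exists>D. weak C \<zeta> D \<and> \<Psi> (conf_map g D)"
      using D(2) conf_map_inv[OF assms(1)] by metis
  qed (use weak_conf_map[OF assms(1)] in blast)
  show ?case
  proof (cases \<phi>)
    case (DiaTau \<psi>)
    then show ?thesis
      using weak_iff[of CTau] IH[of \<psi>] by (simp add: immediate.intros)
  next
    case (DiaAct x a \<psi>)
    have step: "(\<exists>D. weak (conf_map g C) (CAct (g l) a) D \<and> D \<Turnstile> fsubst (fml_rename v g \<psi>) (g l) (v x))
      \<longleftrightarrow> (\<exists>D. weak C (CAct l a) D \<and> D \<Turnstile> fsubst \<psi> l x)" for l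
      unfolding fsubst_fml_rename[OF assms(2)]
      using weak_iff[of "CAct l a"] IH[of "fsubst \<psi> l x"] by (simp add: DiaAct immediate.intros)
    show ?thesis
    proof
      assume "C \<Turnstile> \<phi>"
      then obtain N where N: "finite (- N)" "\<forall>l\<in>N. \<exists>D. weak C (CAct l a) D \<and> D \<Turnstile> fsubst \<psi> l x"
        by (auto simp: DiaAct)
      \<comment> \<open>Complements commute with images under a bijection, so cofiniteness is
        kept.\<close>
      have "finite (- g ` N)"
        using N(1) assms(1) by (simp flip: bij_image_Compl_eq)
      moreover have "\<forall>l\<in>g ` N. \<exists>D. weak (conf_map g C) (CAct l a) D \<and> D \<Turnstile> fsubst (fml_rename v g \<psi>) l (v x)"
        using N(2) step by blast
      ultimately show "conf_map g C \<Turnstile> fml_rename v g \<phi>"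
        by (auto simp: DiaAct)
    next
      assume "conf_map g C \<Turnstile> fml_rename v g \<phi>"
      then obtain N where N: "finite (- N)"
        "\<forall>l\<in>N. \<exists>D. weak (conf_map g C) (CAct l a) D \<and> D \<Turnstile> fsubst (fml_rename v g \<psi>) l (v x)"
        by (auto simp: DiaAct)
      have "finite (- (g -` N))"
        using N(1) assms(1) by (simp add: finite_vimageI bij_is_inj flip: vimage_Compl)
      moreover have "\<forall>l\<in>g -` N. \<exists>D. weak C (CAct l a) D \<and> D \<Turnstile> fsubst \<psi> l x"
        using N(2) step by blast
      ultimately show "C \<Turnstile> \<phi>"
        unfolding DiaAct sat.simps by blast
    qed
  next
    case (Neg \<psi>)
    then show ?thesis
      using IH[of \<psi>] by (simp add: immediate.intros)
  next
    case (Conj F)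
    have "conf_map g C \<Turnstile> fml_rename v g \<psi> \<longleftrightarrow> C \<Turnstile> \<psi>" if "F i = Some \<psi>" for i \<psi>
      using that Conj IH by (blast intro: immediate.intros(4))
    then show ?thesis
      by (simp add: Conj) blast
  next
    case (DiaCo K \<psi>)
    have *: "(\<exists>D. weak (conf_map g C) (CCo (g ` L)) D \<and> D \<Turnstile> fml_rename v g \<psi>) \<longleftrightarrow>
      (\<exists>D. weak C (CCo L) D \<and> D \<Turnstile> \<psi>)" for L
      using weak_iff[of "CCo L"] IH[of \<psi>] by (simp add: DiaCo immediate.intros)
    have inj: "inj (tname_map v g)"
    proof (rule injI)
      show "s = t" if "tname_map v g s = tname_map v g t" for s t
        using that assms by (cases s; cases t) (auto simp: inj_eq bij_is_inj)
    qed
    have "TName ` g ` L = tname_map v g ` TName ` L" for L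
      by (simp add: image_image)
    then have K: "tname_map v g ` K = TName ` g ` L \<longleftrightarrow> K = TName ` L" for L
      using inj by (simp add: inj_image_eq_iff)
    \<comment> \<open>By surjectivity of \<open>g\<close>, every set of target names is an
      image.\<close>
    have "(\<exists>L'. \<Psi> L') \<longleftrightarrow> (\<exists>L. \<Psi> (g ` L))" for \<Psi> :: "'b set \<Rightarrow> bool"
      using assms(1) by (metis bij_is_surj surj_image_vimage_eq)
    then show ?thesis
      using * K by (auto simp: DiaCo)
  qed
qed


section \<open>Bisimilarity and logical equivalence\<close>

lemma cs_bisimulation_conversep: "cs_bisimulation R \<Longrightarrow> cs_bisimulation R\<inverse>\<inverse>"
  by (auto simp: cs_bisimulation_def)

text \<open>Treats all labels at once and expresses freshness through \<open>ext_names\<close>;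
  commit labels carry no freshness condition.\<close>

lemma cs_bisimulation_weak:
  assumes "cs_bisimulation R" "R C1 C2" "weak C1 \<zeta> C1'"
    and "\<And>k a. \<zeta> = CAct k a \<Longrightarrow> k \<notin> ext_names C2"
  shows "\<exists>C2'. weak C2 \<zeta> C2' \<and> R C1' C2'"
proof -
  have sim: "cs_simulation R" and "ext_config C2"
    using assms(1,2) by (auto simp: cs_bisimulation_def)
  show ?thesis
  proof (cases \<zeta>)
    case CTau
    then show ?thesis
      using sim assms(2,3) unfolding cs_simulation_def by (metis clabel_fresh.simps(1))
  next
    case (CAct k a)
    then have "clabel_fresh \<zeta> C2"
      using assms(4) ext_config_ext_names(1)[OF \<open>ext_config C2\<close>] by simp
    then show ?thesis
      using sim assms(2,3) CAct unfolding cs_simulation_def by blast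
  next
    case (CCo K)
    then show ?thesis
      using sim assms(2,3) unfolding cs_simulation_def by blast
  qed
qed

text \<open>The relation is generalised in the induction because negation is handled by passing to
  its converse, which is again a bisimulation.\<close>

lemma cs_bisimulation_sat:
  assumes "cs_bisimulation R" "R C1 C2" "C1 \<Turnstile> \<phi>"
  shows "C2 \<Turnstile> \<phi>"
  using assms
proof (induction \<phi> arbitrary: R C1 C2 rule: wfp_induct_rule[OF wfp_immediate])
  case (1 \<phi>)
  note IH = 1(1) and R = 1(2,3) and sat = 1(4)
  note weak = cs_bisimulation_weak[OF R]
  show ?case
  proof (cases \<phi>)
    case (DiaTau \<psi>)
    then obtain C1' where "weak C1 CTau C1'" "C1' \<Turnstile> \<psi>"
      using sat by auto
    then show ?thesis
      using weak[of CTau C1'] IH[of \<psi> R C1'] R(1) by (auto simp: DiaTau immediate.intros)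
  next
    case (DiaAct x a \<psi>)
    then obtain N where N: "finite (- N)"
      "\<And>l. l \<in> N \<Longrightarrow> \<exists>C1'. weak C1 (CAct l a) C1' \<and> C1' \<Turnstile> fsubst \<psi> l x"
      using sat by auto
    have "ext_config C2"
      using R by (auto simp: cs_bisimulation_def)
    then have "finite (- (N - ext_names C2))"
      using N(1) ext_config_ext_names(2) by (simp add: Compl_Diff_eq)
    moreover have "\<exists>C2'. weak C2 (CAct l a) C2' \<and> C2' \<Turnstile> fsubst \<psi> l x"
      if l: "l \<in> N - ext_names C2" for l
    proof -
      obtain C1' where "weak C1 (CAct l a) C1'" "C1' \<Turnstile> fsubst \<psi> l x"
        using N(2) l by blast
      moreover from this(1) obtain C2' where "weak C2 (CAct l a) C2'" "R C1' C2'"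
        using weak[of "CAct l a" C1'] l by auto
      ultimately show ?thesis
        using IH[of "fsubst \<psi> l x"] R(1) DiaAct immediate.intros(2) by metis
    qed
    ultimately show ?thesis
      unfolding DiaAct sat.simps by blast
  next
    case (Neg \<psi>)
    then show ?thesis
      using sat IH[OF _ cs_bisimulation_conversep[OF R(1)], of \<psi> C2 C1] R(2)
      by (auto simp: immediate.intros)
  next
    case (Conj F)
    have "C2 \<Turnstile> \<psi>" if "F i = Some \<psi>" for i \<psi>
      using that sat Conj IH[of \<psi>] R immediate.intros(4) by (metis sat.simps(4))
    then show ?thesis
      by (simp add: Conj)
  next
    case (DiaCo K \<psi>)
    then obtain K' C1' where "K = TName ` K'" "weak C1 (CCo K') C1'" "C1' \<Turnstile> \<psi>"
      using sat by auto
    then show ?thesis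
      using weak[of "CCo K'" C1'] IH[of \<psi> R C1'] R(1) by (auto simp: DiaCo immediate.intros)
  qed
qed

text \<open>The \<open>itself\<close> argument fixes the index type of conjunctions, which the type
  of configurations leaves undetermined.\<close>

definition agree ::
  "'j itself \<Rightarrow> ('a, 'n, 'x) config \<Rightarrow> ('a, 'n, 'x) config \<Rightarrow> bool" where
  "agree (_ :: 'j itself) C1 C2 \<longleftrightarrow> ext_config C1 \<and> ext_config C2 \<and>
     (\<forall>\<phi> :: ('a, 'x, 'j) fml. closed_formula \<phi> \<longrightarrow>
        fml_names \<phi> \<subseteq> ext_names C1 \<union> ext_names C2 \<longrightarrow> (C1 \<Turnstile> \<phi> \<longleftrightarrow> C2 \<Turnstile> \<phi>))"

lemma agree_sym: "agree T C1 C2 \<Longrightarrow> agree T C2 C1"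
  unfolding agree_def by (auto simp: Un_commute)

lemma agree_conversep: "(agree T)\<inverse>\<inverse> = agree T"
  by (auto simp: fun_eq_iff intro: agree_sym)

lemma closed_formula_DiaTau: "closed_formula \<phi> \<Longrightarrow> closed_formula (DiaTau \<phi>)"
  by (auto simp: closed_formula_def intro: formula.intros elim: free_in_DiaTauE)

lemma closed_formula_Neg: "closed_formula \<phi> \<Longrightarrow> closed_formula (Neg \<phi>)"
  by (auto simp: closed_formula_def intro: formula.intros elim: free_in_NegE)

lemma closed_formula_Conj:
  "(\<And>i \<phi>. F i = Some \<phi> \<Longrightarrow> closed_formula \<phi>) \<Longrightarrow> closed_formula (Conj F)"
  unfolding closed_formula_def by (blast intro: formula.intros(4) elim: free_in_ConjE)

lemma closed_formula_DiaCo: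
  "closed_formula \<phi> \<Longrightarrow> K \<noteq> {} \<Longrightarrow> closed_formula (DiaCo (TName ` K) \<phi>)"
  by (auto simp: closed_formula_def intro: formula.intros elim: free_in_DiaCoE)

lemma closed_formula_DiaAct_abstract:
  "closed_formula \<phi> \<Longrightarrow> closed_formula (DiaAct 0 a (fml_abstract k \<phi>))"
  unfolding closed_formula_def
  by (auto intro: formula.intros formula_fml_abstract elim!: free_in_DiaActE dest: free_in_fml_abstract)

text \<open>Each \<open>D\<close> in \<open>S\<close> is refuted by some formula true at
  \<open>C\<close>; the conjunction of these refutes all of \<open>S\<close> together. Even if
  \<open>S\<close> is infinite, no name outside \<open>M\<close> is introduced.\<close>

lemma separating_formula:
  fixes C :: "('a, 'n, 'x) config" and S :: "('a, 'n, 'x) config set"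
  assumes "ext_config C" "ext_names C \<subseteq> M"
    and S: "\<And>D. D \<in> S \<Longrightarrow> ext_config D \<and> ext_names D \<subseteq> M \<and>
      \<not> agree TYPE('i + ('a, 'n, 'x) config) C D"
  obtains \<phi> :: "('a, 'x, 'i + ('a, 'n, 'x) config) fml"
    where "closed_formula \<phi>" "fml_names \<phi> \<subseteq> M" "C \<Turnstile> \<phi>" "\<And>D. D \<in> S \<Longrightarrow> \<not> D \<Turnstile> \<phi>"
proof -
  have "\<exists>\<phi> :: ('a, 'x, 'i + ('a, 'n, 'x) config) fml.
      closed_formula \<phi> \<and> fml_names \<phi> \<subseteq> M \<and> C \<Turnstile> \<phi> \<and> \<not> D \<Turnstile> \<phi>" if D: "D \<in> S" for D
  proof -
    obtain \<phi> :: "('a, 'x, 'i + ('a, 'n, 'x) config) fml" where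
      "closed_formula \<phi>" "fml_names \<phi> \<subseteq> ext_names C \<union> ext_names D" "(C \<Turnstile> \<phi>) \<noteq> (D \<Turnstile> \<phi>)"
      using S[OF D] assms(1) unfolding agree_def by blast
    then show ?thesis
      using S[OF D] assms(2) closed_formula_Neg[of \<phi>]
      \<comment> \<open>Of the distinguishing formula and its negation, the one that is true at
        \<open>C\<close> is chosen.\<close>
      by (intro exI[of _ "if C \<Turnstile> \<phi> then \<phi> else Neg \<phi>"]) auto
  qed
  then obtain \<chi> :: "('a, 'n, 'x) config \<Rightarrow> ('a, 'x, 'i + ('a, 'n, 'x) config) fml" where
    \<chi>: "\<And>D. D \<in> S \<Longrightarrow> closed_formula (\<chi> D) \<and> fml_names (\<chi> D) \<subseteq> M \<and> C \<Turnstile> \<chi> D \<and> \<not> D \<Turnstile> \<chi> D"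
    by metis
  \<comment> \<open>The conjunct against \<open>D\<close> sits at the index \<open>Inr D\<close>;
    this is where the index type has to contain the configurations.\<close>
  define F :: "'i + ('a, 'n, 'x) config \<Rightarrow> _"
    where "F = case_sum (\<lambda>_. None) (\<lambda>D. if D \<in> S then Some (\<chi> D) else None)"
  have F: "F j = Some \<psi> \<longleftrightarrow> (\<exists>D\<in>S. j = Inr D \<and> \<psi> = \<chi> D)" for j :: "'i + ('a, 'n, 'x) config" and \<psi>
    by (auto simp: F_def split: sum.splits)
  show thesis
  proof
    show "closed_formula (Conj F)"
      by (rule closed_formula_Conj) (auto simp: F \<chi>)
    show "fml_names (Conj F) \<subseteq> M"
    proof
      fix k assume "k \<in> fml_names (Conj F)"
      then obtain D where "D \<in> S" "k \<in> fml_names (\<chi> D)"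
        by (auto simp: F)
      then show "k \<in> M"
        using \<chi> by blast
    qed
    show "C \<Turnstile> Conj F"
      using \<chi> by (auto simp: F)
    show "\<not> D \<Turnstile> Conj F" if "D \<in> S" for D
      using that \<chi>[OF that] F[of "Inr D" "\<chi> D"] by auto
  qed
qed

lemma agree_weak_CAct:
  fixes C1 C2 :: "('a, 'n, 'x::infinite) config"
  assumes "agree TYPE('i + ('a, 'n, 'x) config) C1 C2" "weak C1 (CAct k a) C1'"
    and "k \<notin> ext_names C2"
  shows "\<exists>C2'. weak C2 (CAct k a) C2' \<and> agree TYPE('i + ('a, 'n, 'x) config) C1' C2'"
proof (rule ccontr)
  assume neg: "\<not> ?thesis"
  let ?names = "ext_names C1 \<union> ext_names C2"
  have ext: "ext_config C1" "ext_config C2"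
    using assms(1) by (auto simp: agree_def)
  have k: "k \<notin> ?names"
    using weak_CAct_fresh[OF assms(2)] assms(3) by simp
  \<comment> \<open>If no answer agrees with \<open>C1'\<close>, one formula holds at
    \<open>C1'\<close> and fails at all answers of \<open>C2\<close>. By now \<open>k\<close>
    belongs to the histories and may occur in it.\<close>
  obtain \<phi> :: "('a, 'x, 'i + ('a, 'n, 'x) config) fml" where \<phi>: "closed_formula \<phi>"
    "fml_names \<phi> \<subseteq> insert k ?names" "C1' \<Turnstile> \<phi>" "\<And>D. weak C2 (CAct k a) D \<Longrightarrow> \<not> D \<Turnstile> \<phi>"
  proof (rule separating_formula[where C = C1' and S = "{D. weak C2 (CAct k a) D}"
        and M = "insert k ?names"])
    show "ext_config C1'"
      using weak_ext_config[OF assms(2) ext(1)] .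
    show "ext_names C1' \<subseteq> insert k ?names"
      using ext_names_weak[OF assms(2)] by auto
    show "ext_config D \<and> ext_names D \<subseteq> insert k ?names \<and> \<not> agree TYPE('i + ('a, 'n, 'x) config) C1' D"
      if "D \<in> {D. weak C2 (CAct k a) D}" for D
      using that neg weak_ext_config[OF _ ext(2)] ext_names_weak[of C2 "CAct k a" D] by auto
  qed auto
  define \<psi> where "\<psi> = DiaAct 0 a (fml_abstract k \<phi>)"
  \<comment> \<open>Both \<open>k\<close> and \<open>l\<close> are fresh for \<open>C\<close>, so
    the swap fixes \<open>C\<close> and turns its transition by \<open>k\<close> into one by
    \<open>l\<close>.\<close>
  have swap: "weak C (CAct l a) (conf_map (transpose k l) D) \<and>
      (conf_map (transpose k l) D \<Turnstile> fsubst (fml_abstract k \<phi>) l 0 \<longleftrightarrow> D \<Turnstile> \<phi>)"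
    if "weak C (CAct k a) D" "ext_config C" "ext_names C \<subseteq> ?names" "l \<notin> insert k ?names" for C D l
  proof -
    have "conf_map (transpose k l) C = C"
      using that k by (intro conf_map_ident) (auto simp: transpose_def)
    moreover have "l \<notin> fml_names \<phi>"
      using that(4) \<phi>(2) by blast
    ultimately show ?thesis
      using weak_conf_map[OF bij_transpose that(1), of k l]
        sat_conf_map[OF bij_transpose, of Suc k l D \<phi>] by (simp add: fsubst_fml_abstract)
  qed
  have fin: "finite (insert k ?names)"
    using ext by (simp add: ext_config_ext_names(2))
  have "C1 \<Turnstile> \<psi>"
    unfolding \<psi>_def sat.simps
  \<comment> \<open>The witness omits \<open>k\<close> too, since \<open>swap\<close> assumes
    \<open>l\<close> outside \<open>insert k ?names\<close>.\<close>
  proof (intro exI[of _ "- insert k ?names"] conjI ballI)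
    fix l assume "l \<in> - insert k ?names"
    then show "\<exists>C'. weak C1 (CAct l a) C' \<and> C' \<Turnstile> fsubst (fml_abstract k \<phi>) l 0"
      using swap[OF assms(2) ext(1), of l] \<phi>(3) by blast
  qed (use fin in simp)
  moreover have "\<not> C2 \<Turnstile> \<psi>"
  proof
    assume "C2 \<Turnstile> \<psi>"
    then obtain N where N: "finite (- N)"
      "\<And>l. l \<in> N \<Longrightarrow> \<exists>D. weak C2 (CAct l a) D \<and> D \<Turnstile> fsubst (fml_abstract k \<phi>) l 0"
      by (auto simp: \<psi>_def)
    \<comment> \<open>As there are infinitely many external names, a cofinite set is not exhausted
      by the finitely many names to be avoided.\<close>
    obtain l where l: "l \<in> N" "l \<notin> insert k ?names"
      using ex_new_if_finite[OF infinite_UNIV, of "- N \<union> insert k ?names"] N(1) fin by auto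
    then obtain D where D: "weak C2 (CAct l a) D" "D \<Turnstile> fsubst (fml_abstract k \<phi>) l 0"
      using N(2) by blast
    \<comment> \<open>Swapping back turns the answer by \<open>l\<close> into an answer by
      \<open>k\<close>, where \<open>\<phi>\<close> fails.\<close>
    let ?D = "conf_map (transpose k l) D"
    have "conf_map (transpose k l) C2 = C2"
      using k l ext by (intro conf_map_ident) (auto simp: transpose_def)
    then have "weak C2 (CAct k a) ?D"
      using weak_conf_map[OF bij_transpose D(1), of k l] by simp
    moreover have "conf_map (transpose k l) ?D = D"
      by (simp add: conf_map_comp conf_map_id)
    ultimately show False
      using swap[of C2 ?D l] ext(2) l(2) D(2) \<phi>(4) by auto
  qed
  moreover have "closed_formula \<psi>"
    unfolding \<psi>_def using \<phi>(1) by (rule closed_formula_DiaAct_abstract)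
  \<comment> \<open>With \<open>k\<close> abstracted away, the agreement of \<open>C1\<close> and
    \<open>C2\<close> applies to \<open>\<psi>\<close>.\<close>
  moreover have "fml_names \<psi> \<subseteq> ?names"
    using fml_names_abstract[of k \<phi>] \<phi>(2) by (auto simp: \<psi>_def)
  ultimately show False
    using assms(1) unfolding agree_def by blast
qed

text \<open>Labels other than visible actions add no names, so the separating formula can be put
  under the modality of the label without abstraction.\<close>

lemma agree_weak:
  fixes C1 C2 :: "('a, 'n, 'x::infinite) config"
  assumes "agree TYPE('i + ('a, 'n, 'x) config) C1 C2" "weak C1 \<zeta> C1'"
    and fresh: "\<And>k a. \<zeta> = CAct k a \<Longrightarrow> k \<notin> ext_names C2"
  shows "\<exists>C2'. weak C2 \<zeta> C2' \<and> agree TYPE('i + ('a, 'n, 'x) config) C1' C2'"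
proof (cases "\<exists>k a. \<zeta> = CAct k a")
  case True
  then show ?thesis
    using agree_weak_CAct assms by blast
next
  case False
  then have new: "clabel_new \<zeta> = {}"
    by (cases \<zeta>) auto
  let ?names = "ext_names C1 \<union> ext_names C2"
  have ext: "ext_config C1" "ext_config C2"
    using assms(1) by (auto simp: agree_def)
  show ?thesis
  proof (rule ccontr)
    assume neg: "\<not> ?thesis"
    obtain \<phi> :: "('a, 'x, 'i + ('a, 'n, 'x) config) fml" where \<phi>: "closed_formula \<phi>"
      "fml_names \<phi> \<subseteq> ?names" "C1' \<Turnstile> \<phi>" "\<And>D. weak C2 \<zeta> D \<Longrightarrow> \<not> D \<Turnstile> \<phi>"
    proof (rule separating_formula[where C = C1' and S = "{D. weak C2 \<zeta> D}" and M = ?names])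
      show "ext_config C1'"
        using weak_ext_config[OF assms(2) ext(1)] .
      show "ext_names C1' \<subseteq> ?names"
        using ext_names_weak[OF assms(2)] new by auto
      show "ext_config D \<and> ext_names D \<subseteq> ?names \<and> \<not> agree TYPE('i + ('a, 'n, 'x) config) C1' D"
        if "D \<in> {D. weak C2 \<zeta> D}" for D
        using that neg new weak_ext_config[OF _ ext(2)] ext_names_weak[of C2 \<zeta> D] by auto
    qed auto
    obtain \<psi> :: "('a, 'x, 'i + ('a, 'n, 'x) config) fml" where
      \<psi>: "closed_formula \<psi>" "fml_names \<psi> \<subseteq> ?names"
      "\<And>C :: ('a, 'n, 'x) config. C \<Turnstile> \<psi> \<longleftrightarrow> (\<exists>C'. weak C \<zeta> C' \<and> C' \<Turnstile> \<phi>)"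
    proof (cases \<zeta>)
      case CTau
      then show ?thesis
        using \<phi>(1,2) by (intro that[of "DiaTau \<phi>"]) (simp_all add: closed_formula_DiaTau)
    next
      case (CCo K)
      have K: "K \<noteq> {}" "K \<subseteq> ext_names C1"
        using weak_CCo assms(2) CCo by blast+
      \<comment> \<open>Injectivity of \<open>TName\<close> makes the set in the modality determine
        the label of the transition.\<close>
      have "TName ` K = TName ` K' \<longleftrightarrow> K = K'" for K'
        by (rule inj_image_eq_iff) (simp add: inj_def)
      then show ?thesis
        using \<phi>(1,2) K CCo by (intro that[of "DiaCo (TName ` K) \<phi>"]) (auto simp: closed_formula_DiaCo)
    qed (use False in auto)
    have "C1 \<Turnstile> \<psi> \<longleftrightarrow> C2 \<Turnstile> \<psi>"
      using assms(1) \<psi>(1,2) unfolding agree_def by blast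
    then show False
      using assms(2) \<phi>(3,4) unfolding \<psi>(3) by blast
  qed
qed

lemma cs_simulation_agree:
  "cs_simulation (agree TYPE('i + ('a, 'n, 'x::infinite) config) :: ('a, 'n, 'x) config \<Rightarrow> _)"
  unfolding cs_simulation_def
proof (intro allI impI conjI)
  fix C1 C2 :: "('a, 'n, 'x) config" and \<zeta> C1'
  assume agree: "agree TYPE('i + ('a, 'n, 'x) config) C1 C2" and weak: "weak C1 \<zeta> C1'"
    and fresh: "clabel_fresh \<zeta> C2"
  have "ext_config C2"
    using agree by (simp add: agree_def)
  then have "k \<notin> ext_names C2" if "\<zeta> = CAct k a" for k a
    using that fresh ext_config_ext_names(1)[OF \<open>ext_config C2\<close>, of k] by simp
  then show "\<exists>C2'. weak C2 \<zeta> C2' \<and> agree TYPE('i + ('a, 'n, 'x) config) C1' C2'"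
    using agree_weak[OF agree weak] by blast
qed (use agree_weak in blast)

text \<open>As \<open>'i\<close> is arbitrary, conjunctions may be as large as desired; the second
  summand provides one index per configuration.\<close>

theorem proposition4p14:
  fixes C1 C2 :: "('a::infinite, 'n::infinite, 'x::infinite) config"
  assumes "ext_config C1" and "ext_config C2"
  shows "C1 \<approx>\<^sub>C C2 \<longleftrightarrow>
    (logic C1 :: ('a, 'x, 'i + ('a, 'n, 'x) config) fml set) = logic C2"
proof
  assume "C1 \<approx>\<^sub>C C2"
  then obtain R where R: "cs_bisimulation R" "R C1 C2"
    by (auto simp: canco_bisimilar_def)
  have "C1 \<Turnstile> \<phi> \<longleftrightarrow> C2 \<Turnstile> \<phi>" for \<phi> :: "('a, 'x, 'i + ('a, 'n, 'x) config) fml"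
    using cs_bisimulation_sat[OF R, of \<phi>]
      cs_bisimulation_sat[OF cs_bisimulation_conversep[OF R(1)], of C2 C1 \<phi>] R(2) by auto
  then show "(logic C1 :: ('a, 'x, 'i + ('a, 'n, 'x) config) fml set) = logic C2"
    by (simp add: logic_def)
next
  assume eq: "(logic C1 :: ('a, 'x, 'i + ('a, 'n, 'x) config) fml set) = logic C2"
  let ?R = "agree TYPE('i + ('a, 'n, 'x) config) :: ('a, 'n, 'x) config \<Rightarrow> _"
  have "C1 \<Turnstile> \<phi> \<longleftrightarrow> C2 \<Turnstile> \<phi>" if "closed_formula \<phi>"
    for \<phi> :: "('a, 'x, 'i + ('a, 'n, 'x) config) fml"
    using that eq by (auto simp: logic_def set_eq_iff)
  \<comment> \<open>Equality of the logics covers all closed formulae, in particular those with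
    restricted names.\<close>
  then have "?R C1 C2"
    using assms by (simp add: agree_def)
  \<comment> \<open>The relation is its own converse, so one simulation settles both
    directions.\<close>
  moreover have "cs_bisimulation ?R"
    using cs_simulation_agree by (auto simp: cs_bisimulation_def agree_conversep agree_def)
  ultimately show "C1 \<approx>\<^sub>C C2"
    unfolding canco_bisimilar_def by blast
qed

end
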